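(* Let $1\leq p\leq q\leq\infty$, and let $E$ be a locally convex space. The following assertions are equivalent: (i) every $(p,q)$-$(V^\ast)$ subset of $E$ is precompact; (ii) for every locally convex space $L$, each operator $T:L\to E$ which transforms bounded subsets of $L$ to $(p,q)$-$(V^\ast)$ subsets of $E$ transforms bounded subsets of $L$ to precompact subsets of $E$; (iii) the same as (ii), but only for normed spaces $L$. If in addition $E$ is locally complete, then (i)--(iii) are equivalent to (iv) the same as (ii), but only for Banach spaces $L$. The same statement holds with "$(p,q)$-$(V^\ast)$" replaced everywhere by "$(p,q)$-$(EV^\ast)$".
   Context: All locally convex spaces are Hausdorff, over $\mathbb{F}\in\{\mathbb{R},\mathbb{C}\}$. An operator is a continuous linear map. $E'$ is the topological dual of $E$, and $E'_\beta$ is $E'$ with the strong topology $\beta(E',E)$. A subset $B\subseteq E'$ is equicontinuous if $B\subseteq U^\circ=\{\chi\in E':|\langle\chi,x\rangle|\le1\ \forall x\in U\}$ for some neighborhood $U$ of zero in $E$. A sequence $\{x_n\}_{n\in\omega}$ in a locally convex space $F$ is weakly $p$-summable if $(\langle\chi,x_n\rangle)_n\in\ell_p$ (or $\in c_0$ if $p=\infty$) for every $\chi\in F'$. A non-empty subset $A$ of $E$ is a $(p,q)$-$(V^\ast)$ set (resp. a $(p,q)$-$(EV^\ast)$ set) if $\big(\sup_{a\in A}|\langle\chi_n,a\rangle|\big)_n\in\ell_q$ (or $\in c_0$ if $q=\infty$) for every weakly $p$-summable sequence (resp. every equicontinuous weakly $p$-summable sequence) $\{\chi_n\}_{n\in\omega}$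 in $E'_\beta$. A subset $A$ of $E$ is precompact if for every neighborhood $U$ of zero there is a finite $F\subseteq E$ with $A\subseteq F+U$. $E$ is locally complete if the closed absolutely convex hull of every null sequence in $E$ is compact. *)

theory Defs
  imports "HOL-Analysis.Analysis" "HOL-Algebra.Module" "HOL-Algebra.AbelCoset"
begin

text \<open>
  The scalar field is a set \<open>K\<close> of complex numbers, which is meant to be \<open>\<real>\<close> or \<open>UNIV\<close>.
  Vector spaces over \<open>K\<close> are modules over \<open>K\<close> in the sense of HOL-Algebra, with an explicit
  carrier, so that one can quantify over all of them within a given type. If \<open>E\<close> lives in the
  type \<open>'a\<close>, a quantifier over all spaces \<open>L\<close> is rendered by one over the spaces living in
  \<open>'a + 'b\<close> with \<open>'b\<close> an arbitrary type: the right summand accommodates any given space, and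
  the left one ensures that spaces as large as \<open>E\<close> are always included.
  The record fields \<open>mult\<close> and \<open>one\<close> inherited from rings play no role for vectors.
\<close>

record 'a topvec = "(complex, 'a) module" +
  topol :: "'a topology"

definition scalar_field :: "complex set \<Rightarrow> complex topvec" where
  "scalar_field K = \<lparr>carrier = K, monoid.mult = (*), one = 1, ring.zero = 0, add = (+),
     smult = (*), topol = top_of_set K\<rparr>"


subsection \<open>Locally convex spaces\<close>

definition zero_nbhd :: "'a topvec \<Rightarrow> 'a set \<Rightarrow> bool" where
  "zero_nbhd E U \<longleftrightarrow> U \<subseteq> carrier E \<and> (\<exists>W. openin (topol E) W \<and> \<zero>\<^bsub>E\<^esub> \<in> W \<and> W \<subseteq> U)"

definition convex_subset :: "'a topvec \<Rightarrow> 'a set \<Rightarrow> bool" where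
  "convex_subset E C \<longleftrightarrow> C \<subseteq> carrier E \<and>
     (\<forall>x\<in>C. \<forall>y\<in>C. \<forall>t\<in>{0..1::real}.
        (complex_of_real (1 - t) \<odot>\<^bsub>E\<^esub> x) \<oplus>\<^bsub>E\<^esub> (complex_of_real t \<odot>\<^bsub>E\<^esub> y) \<in> C)"

locale locally_convex_space = Module.module "scalar_field K" E
  for K :: "complex set" and E :: "'a topvec" (structure) +
  assumes topspace_eq_carrier: "topspace (topol E) = carrier E"
    and continuous_add:
      "continuous_map (prod_topology (topol E) (topol E)) (topol E) (\<lambda>(x, y). x \<oplus> y)"
    and continuous_smult:
      "continuous_map (prod_topology (top_of_set K) (topol E)) (topol E) (\<lambda>(c, x). c \<odot> x)"
    and Hausdorff: "Hausdorff_space (topol E)"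
    and locally_convex: "zero_nbhd E U \<Longrightarrow> \<exists>C. zero_nbhd E C \<and> convex_subset E C \<and> C \<subseteq> U"

definition bounded_subset :: "'a topvec \<Rightarrow> 'a set \<Rightarrow> bool" where
  "bounded_subset E A \<longleftrightarrow> A \<subseteq> carrier E \<and>
     (\<forall>U. zero_nbhd E U \<longrightarrow> (\<exists>r>0. A \<subseteq> (\<lambda>x. complex_of_real r \<odot>\<^bsub>E\<^esub> x) ` U))"

definition precompact_subset :: "'a topvec \<Rightarrow> 'a set \<Rightarrow> bool" where
  "precompact_subset E A \<longleftrightarrow> A \<subseteq> carrier E \<and>
     (\<forall>U. zero_nbhd E U \<longrightarrow> (\<exists>F. finite F \<and> F \<subseteq> carrier E \<and> A \<subseteq> F <+>\<^bsub>E\<^esub> U))"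

definition abs_convex :: "complex set \<Rightarrow> 'a topvec \<Rightarrow> 'a set \<Rightarrow> bool" where
  "abs_convex K E C \<longleftrightarrow> C \<subseteq> carrier E \<and>
     (\<forall>x\<in>C. \<forall>y\<in>C. \<forall>a\<in>K. \<forall>b\<in>K. cmod a + cmod b \<le> 1 \<longrightarrow>
        (a \<odot>\<^bsub>E\<^esub> x) \<oplus>\<^bsub>E\<^esub> (b \<odot>\<^bsub>E\<^esub> y) \<in> C)"

definition locally_complete :: "complex set \<Rightarrow> 'a topvec \<Rightarrow> bool" where
  "locally_complete K E \<longleftrightarrow>
     (\<forall>x. range x \<subseteq> carrier E \<and> limitin (topol E) x \<zero>\<^bsub>E\<^esub> sequentially \<longrightarrow>
        compactin (topol E) ((\<lambda>C. closedin (topol E) C \<and> abs_convex K E C) hull (range x)))"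


subsection \<open>Normed spaces and Banach spaces\<close>

definition norm_on :: "complex set \<Rightarrow> 'a topvec \<Rightarrow> ('a \<Rightarrow> real) \<Rightarrow> bool" where
  "norm_on K L N \<longleftrightarrow>
     (\<forall>x\<in>carrier L. 0 \<le> N x \<and> (N x = 0 \<longleftrightarrow> x = \<zero>\<^bsub>L\<^esub>)) \<and>
     (\<forall>c\<in>K. \<forall>x\<in>carrier L. N (c \<odot>\<^bsub>L\<^esub> x) = cmod c * N x) \<and>
     (\<forall>x\<in>carrier L. \<forall>y\<in>carrier L. N (x \<oplus>\<^bsub>L\<^esub> y) \<le> N x + N y)"

text \<open>The library's metric spaces require a distance that is nonnegative and symmetric on the
  whole type, hence the value 0 off the carrier.\<close>

definition norm_dist :: "'a topvec \<Rightarrow> ('a \<Rightarrow> real) \<Rightarrow> 'a \<Rightarrow> 'a \<Rightarrow> real" where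
  "norm_dist L N x y = (if x \<in> carrier L \<and> y \<in> carrier L then N (x \<ominus>\<^bsub>L\<^esub> y) else 0)"

definition normed_space :: "complex set \<Rightarrow> 'a topvec \<Rightarrow> bool" where
  "normed_space K L \<longleftrightarrow> Module.module (scalar_field K) L \<and>
     (\<exists>N. norm_on K L N \<and> topol L = Metric_space.mtopology (carrier L) (norm_dist L N))"

definition banach_space :: "complex set \<Rightarrow> 'a topvec \<Rightarrow> bool" where
  "banach_space K L \<longleftrightarrow> Module.module (scalar_field K) L \<and>
     (\<exists>N. norm_on K L N \<and> topol L = Metric_space.mtopology (carrier L) (norm_dist L N) \<and>
          Metric_space.mcomplete (carrier L) (norm_dist L N))"


subsection \<open>Operators and the strong dual\<close>

definition operator :: "complex set \<Rightarrow> 'a topvec \<Rightarrow> 'b topvec \<Rightarrow> ('a \<Rightarrow> 'b) \<Rightarrow> bool" where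
  "operator K L E T \<longleftrightarrow> continuous_map (topol L) (topol E) T \<and>
     (\<forall>x\<in>carrier L. \<forall>y\<in>carrier L. T (x \<oplus>\<^bsub>L\<^esub> y) = T x \<oplus>\<^bsub>E\<^esub> T y) \<and>
     (\<forall>c\<in>K. \<forall>x\<in>carrier L. T (c \<odot>\<^bsub>L\<^esub> x) = c \<odot>\<^bsub>E\<^esub> T x)"

text \<open>Functionals are normalised to vanish off the carrier, so that functionals which agree on
  the space are equal.\<close>

definition dual :: "complex set \<Rightarrow> 'a topvec \<Rightarrow> ('a \<Rightarrow> complex) set" where
  "dual K E = {\<phi>. operator K E (scalar_field K) \<phi> \<and> (\<forall>x. x \<notin> carrier E \<longrightarrow> \<phi> x = 0)}"

text \<open>The strong topology is generated by the open balls of the seminorms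
  \<open>\<phi> \<mapsto> sup {\<bar>\<phi> x\<bar> | x \<in> B}\<close> with \<open>B\<close> bounded; the bound \<open>d < e\<close> says that
  this supremum (of \<open>\<psi> - \<phi>\<close>) is less than \<open>e\<close>.\<close>

definition strong_topology :: "complex set \<Rightarrow> 'a topvec \<Rightarrow> ('a \<Rightarrow> complex) topology" where
  "strong_topology K E = topology_generated_by
     {{\<psi> \<in> dual K E. \<exists>d<e. \<forall>x\<in>B. cmod (\<psi> x - \<phi> x) \<le> d} | \<phi> B e.
        \<phi> \<in> dual K E \<and> bounded_subset E B \<and> 0 < e}"

definition strong_dual :: "complex set \<Rightarrow> 'a topvec \<Rightarrow> ('a \<Rightarrow> complex) topvec" where
  "strong_dual K E = \<lparr>carrier = dual K E, monoid.mult = undefined, one = undefined,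
     ring.zero = (\<lambda>x. 0), add = (\<lambda>\<phi> \<psi> x. \<phi> x + \<psi> x),
     smult = (\<lambda>c \<phi> x. c * \<phi> x), topol = strong_topology K E\<rparr>"

definition polar :: "complex set \<Rightarrow> 'a topvec \<Rightarrow> 'a set \<Rightarrow> ('a \<Rightarrow> complex) set" where
  "polar K E U = {\<phi> \<in> dual K E. \<forall>x\<in>U. cmod (\<phi> x) \<le> 1}"

definition equicontinuous :: "complex set \<Rightarrow> 'a topvec \<Rightarrow> ('a \<Rightarrow> complex) set \<Rightarrow> bool" where
  "equicontinuous K E B \<longleftrightarrow> (\<exists>U. zero_nbhd E U \<and> B \<subseteq> polar K E U)"


subsection \<open>Weakly summable sequences and the two classes of sets\<close>

text \<open>For \<open>p = \<infinity>\<close> the space \<open>c\<^sub>0\<close> takes the place of the bounded sequences.\<close>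

definition in_lp :: "ennreal \<Rightarrow> (nat \<Rightarrow> real) \<Rightarrow> bool" where
  "in_lp p a \<longleftrightarrow>
     (if p = \<infinity> then a \<longlonglongrightarrow> 0 else summable (\<lambda>n. \<bar>a n\<bar> powr enn2real p))"

definition weakly_summable ::
    "complex set \<Rightarrow> ennreal \<Rightarrow> 'a topvec \<Rightarrow> (nat \<Rightarrow> 'a) \<Rightarrow> bool" where
  "weakly_summable K p F x \<longleftrightarrow> range x \<subseteq> carrier F \<and>
     (\<forall>\<phi>\<in>dual K F. in_lp p (\<lambda>n. cmod (\<phi> (x n))))"

text \<open>The suprema have to be finite for their sequence to lie in \<open>\<ell>\<^sub>q\<close> or \<open>c\<^sub>0\<close>. This is
  demanded explicitly, because the real-valued supremum is unspecified for unbounded sets.\<close>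

definition sup_in_lp :: "ennreal \<Rightarrow> 'a set \<Rightarrow> (nat \<Rightarrow> 'a \<Rightarrow> complex) \<Rightarrow> bool" where
  "sup_in_lp q A \<phi> \<longleftrightarrow> (\<forall>n. bdd_above ((\<lambda>a. cmod (\<phi> n a)) ` A)) \<and>
     in_lp q (\<lambda>n. SUP a\<in>A. cmod (\<phi> n a))"

definition V_star_set ::
    "complex set \<Rightarrow> ennreal \<Rightarrow> ennreal \<Rightarrow> 'a topvec \<Rightarrow> 'a set \<Rightarrow> bool" where
  "V_star_set K p q E A \<longleftrightarrow> A \<noteq> {} \<and> A \<subseteq> carrier E \<and>
     (\<forall>\<phi>. weakly_summable K p (strong_dual K E) \<phi> \<longrightarrow> sup_in_lp q A \<phi>)"

definition EV_star_set ::
    "complex set \<Rightarrow> ennreal \<Rightarrow> ennreal \<Rightarrow> 'a topvec \<Rightarrow> 'a set \<Rightarrow> bool" where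
  "EV_star_set K p q E A \<longleftrightarrow> A \<noteq> {} \<and> A \<subseteq> carrier E \<and>
     (\<forall>\<phi>. weakly_summable K p (strong_dual K E) \<phi> \<and> equicontinuous K E (range \<phi>) \<longrightarrow>
        sup_in_lp q A \<phi>)"

text \<open>\<open>maps_bounded_to P L T\<close>: the map \<open>T\<close> transforms bounded subsets of \<open>L\<close> to sets with
  property \<open>P\<close>. The empty set is left out, since \<open>(p,q)\<close>-\<open>(V\<^sup>*)\<close> and \<open>(p,q)\<close>-\<open>(EV\<^sup>*)\<close> sets
  are non-empty by definition.\<close>

definition maps_bounded_to :: "('b set \<Rightarrow> bool) \<Rightarrow> 'a topvec \<Rightarrow> ('a \<Rightarrow> 'b) \<Rightarrow> bool" where
  "maps_bounded_to P L T \<longleftrightarrow> (\<forall>B. bounded_subset L B \<and> B \<noteq> {} \<longrightarrow> P (T ` B))"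

end

theory Submission
  imports Defs
begin

text \<open>
  That (i) implies the other assertions is immediate, and normed spaces are locally convex, so the
  content lies in the implications from (iii) and, for locally complete \<open>E\<close>, from (iv) to (i). Let
  \<open>A\<close> be a \<open>(p,q)\<close>-\<open>(V\<^sup>*)\<close> or \<open>(p,q)\<close>-\<open>(EV\<^sup>*)\<close> set; in either case it is a \<open>(p,q)\<close>-\<open>(EV\<^sup>*)\<close> set.

  Such a set is bounded (\<open>EV_star_bounded\<close>). If a continuous seminorm \<open>g\<close> exceeds \<open>4\<^sup>n\<close> at some
  \<open>a n \<in> A\<close> for every \<open>n\<close>, the Hahn-Banach theorem yields functionals \<open>\<phi> n\<close> with
  \<open>\<bar>\<phi> n\<bar> \<le> 2\<^sup>-\<^sup>n g\<close> and \<open>\<bar>\<phi> n (a n)\<bar> > 2\<^sup>n\<close>. They form an equicontinuous sequence, which is weakly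
  \<open>p\<close>-summable because every functional on the strong dual is bounded on the polar of
  \<open>{x. g x \<le> 1}\<close> (\<open>bidual_bound\<close>); but the suprema of \<open>\<bar>\<phi> n\<bar>\<close> over \<open>A\<close> are not even a null sequence.

  Let \<open>D\<close> be the closed absolutely convex hull of \<open>A\<close>, a bounded set, and let \<open>L\<close> be its linear span,
  normed by the Minkowski functional of \<open>D\<close>. This is a norm because \<open>D\<close> is bounded and \<open>E\<close> is
  Hausdorff, and the inclusion of \<open>L\<close> into \<open>E\<close> is continuous, again because \<open>D\<close> is bounded. The
  supremum of a functional over \<open>D\<close> equals that over \<open>A\<close>, and a bounded subset of \<open>L\<close> is contained in
  a multiple of \<open>D\<close>; hence the inclusion maps bounded sets to sets of the same class as \<open>A\<close>
  (\<open>star_set_of_minkowski_bounded\<close>). By (iii) it maps \<open>D\<close> to a precompact set, and \<open>A \<subseteq> D\<close>.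

  If \<open>E\<close> is locally complete, the same \<open>L\<close> is a Banach space (\<open>minkowski_complete\<close>), so that (iv) suffices.

  Topological questions about \<open>E\<close> are reduced to its continuous seminorms
  (\<open>openin_iff_seminorm\<close>). Hahn-Banach is derived from minimal sublinear functions, which are
  additive (\<open>minimal_sublinear_additive\<close>); this avoids functionals on subspaces and their
  extension.
\<close>


section \<open>Membership in \<open>\<ell>\<^sub>p\<close> and \<open>c\<^sub>0\<close>\<close>

lemma one_le_enn2real:
  assumes "1 \<le> p" "p \<noteq> (\<infinity>::ennreal)"
  shows "1 \<le> enn2real p"
  using enn2real_mono[OF assms(1)] assms(2) by (simp add: top.not_eq_extremum)

lemma in_lp_dominated:
  assumes p: "1 \<le> p" and a: "in_lp p a" and ba: "\<And>n. \<bar>b n\<bar> \<le> r * \<bar>a n\<bar>" and r: "0 \<le> r"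
  shows "in_lp p b"
proof (cases "p = \<infinity>")
  case True
  then have "a \<longlonglongrightarrow> 0" using a by (simp add: in_lp_def)
  then have "(\<lambda>n. r * \<bar>a n\<bar>) \<longlonglongrightarrow> 0"
    by (intro tendsto_mult_right_zero tendsto_rabs_zero)
  then have "b \<longlonglongrightarrow> 0"
    by (rule Lim_null_comparison[rotated]) (simp add: ba)
  then show ?thesis using True by (simp add: in_lp_def)
next
  case False
  define s where "s = enn2real p"
  have s: "1 \<le> s" using one_le_enn2real[OF p False] by (simp add: s_def)
  have "summable (\<lambda>n. \<bar>a n\<bar> powr s)" using a False by (simp add: in_lp_def s_def)
  then have "summable (\<lambda>n. r powr s * \<bar>a n\<bar> powr s)" by (rule summable_mult)
  moreover have "norm (\<bar>b n\<bar> powr s) \<le> r powr s * \<bar>a n\<bar> powr s" for n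
  proof -
    have "\<bar>b n\<bar> powr s \<le> (r * \<bar>a n\<bar>) powr s"
      using s by (intro powr_mono2 ba) auto
    then show ?thesis using r by (simp add: powr_mult)
  qed
  ultimately have "summable (\<lambda>n. \<bar>b n\<bar> powr s)"
    by (rule summable_comparison_test'[where N = 0])
  then show ?thesis using False by (simp add: in_lp_def s_def)
qed

lemma in_lp_geometric:
  assumes "1 \<le> p"
  shows "in_lp p (\<lambda>n. (1/2) ^ n)"
proof (cases "p = \<infinity>")
  case True
  then show ?thesis by (simp add: in_lp_def LIMSEQ_power_zero)
next
  case False
  have "((1/2::real) ^ n) powr enn2real p \<le> (1/2) ^ n" for n
    using powr_mono'[of 1 "enn2real p" "(1/2::real)^n"] one_le_enn2real[OF assms False]
    by (simp add: power_le_one)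
  then have "summable (\<lambda>n. ((1/2::real) ^ n) powr enn2real p)"
    by (intro summable_comparison_test'[OF summable_geometric[of "1/2::real"], of 0]) simp_all
  then show ?thesis using False by (simp add: in_lp_def)
qed

lemma in_lp_less_one:
  assumes p: "1 \<le> p" and a: "in_lp p a"
  shows "\<exists>n. \<bar>a n\<bar> < 1"
proof (cases "p = \<infinity>")
  case True
  then have "a \<longlonglongrightarrow> 0" using a by (simp add: in_lp_def)
  then have "\<forall>\<^sub>F n in sequentially. \<bar>a n\<bar> < 1"
    using tendstoD[of a 0 sequentially 1] by simp
  then show ?thesis by (auto simp: eventually_sequentially)
next
  case False
  then have "(\<lambda>n. \<bar>a n\<bar> powr enn2real p) \<longlonglongrightarrow> 0"
    using a by (auto simp: in_lp_def intro: summable_LIMSEQ_zero)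
  then have "\<forall>\<^sub>F n in sequentially. \<bar>a n\<bar> powr enn2real p < 1"
    by (rule order_tendstoD(2)) simp
  then obtain n where n: "\<bar>a n\<bar> powr enn2real p < 1" by (auto simp: eventually_sequentially)
  have "\<bar>a n\<bar> < 1"
  proof (rule ccontr)
    assume "\<not> \<bar>a n\<bar> < 1"
    then have "1 \<le> \<bar>a n\<bar> powr enn2real p" by (intro ge_one_powr_ge_zero) auto
    then show False using n by simp
  qed
  then show ?thesis ..
qed

text \<open>The domination is stated for all bounds \<open>s\<close> on \<open>A\<close> instead of the supremum, as this is what
  passing to a convex hull or a closure provides.\<close>
lemma sup_in_lp_dominated:
  assumes q: "1 \<le> q" and A: "sup_in_lp q A \<phi>" "A \<noteq> {}" and B: "B \<noteq> {}" and r: "0 \<le> r"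
    and dom: "\<And>n s b. (\<And>a. a \<in> A \<Longrightarrow> cmod (\<phi> n a) \<le> s) \<Longrightarrow> b \<in> B \<Longrightarrow> cmod (\<phi> n b) \<le> r * s"
  shows "sup_in_lp q B \<phi>"
proof -
  let ?a = "\<lambda>n. SUP a\<in>A. cmod (\<phi> n a)" and ?b = "\<lambda>n. SUP b\<in>B. cmod (\<phi> n b)"
  have bdd: "bdd_above ((\<lambda>a. cmod (\<phi> n a)) ` A)" for n using A(1) by (simp add: sup_in_lp_def)
  have le: "cmod (\<phi> n b) \<le> r * ?a n" if "b \<in> B" for n b
    by (rule dom[OF _ that]) (auto intro: cSUP_upper bdd)
  have a0: "0 \<le> ?a n" for n
    using A(2) cSUP_upper2[OF bdd, of _ 0 n] by (auto simp: ex_in_conv[symmetric])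
  have bddB: "bdd_above ((\<lambda>a. cmod (\<phi> n a)) ` B)" for n by (rule bdd_aboveI2[OF le])
  have b0: "0 \<le> ?b n" for n
    using B cSUP_upper2[OF bddB, of _ 0 n] by (auto simp: ex_in_conv[symmetric])
  have "?b n \<le> r * ?a n" for n using B le by (auto intro: cSUP_least)
  then have "in_lp q ?b"
    using A(1) a0 b0 r q by (intro in_lp_dominated[of q ?a ?b r]) (auto simp: sup_in_lp_def)
  then show ?thesis using bddB by (simp add: sup_in_lp_def)
qed


section \<open>Vector spaces over the scalar field\<close>

locale scalar_module = Module.module "scalar_field K" E
  for K :: "complex set" and E :: "'a topvec" (structure) +
  assumes K_cases: "K \<in> {\<real>, UNIV}"
begin

lemma of_real_K [simp]: "complex_of_real r \<in> K"
  using K_cases by auto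

lemma K_closed [simp]:
  shows "1 \<in> K" "0 \<in> K"
    and "a \<in> K \<Longrightarrow> - a \<in> K" "a \<in> K \<Longrightarrow> inverse a \<in> K"
    and "a \<in> K \<Longrightarrow> b \<in> K \<Longrightarrow> a + b \<in> K" "a \<in> K \<Longrightarrow> b \<in> K \<Longrightarrow> a * b \<in> K"
    and "a \<in> K \<Longrightarrow> b \<in> K \<Longrightarrow> a - b \<in> K" "a \<in> K \<Longrightarrow> b \<in> K \<Longrightarrow> a / b \<in> K"
  using K_cases by (elim insertE; simp)+

lemma K_numeral [simp]: "numeral n \<in> K"
  using K_cases by (elim insertE; simp)

lemma K_power [simp]: "a \<in> K \<Longrightarrow> a ^ n \<in> K"
  by (induction n) simp_all

lemma scale_closed [simp]: "a \<in> K \<Longrightarrow> x \<in> carrier E \<Longrightarrow> a \<odot> x \<in> carrier E"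
  using smult_closed[of a x] by (simp add: scalar_field_def)

lemma scale_left_distrib:
  "a \<in> K \<Longrightarrow> b \<in> K \<Longrightarrow> x \<in> carrier E \<Longrightarrow> (a + b) \<odot> x = a \<odot> x \<oplus> b \<odot> x"
  using smult_l_distr[of a b x] by (simp add: scalar_field_def)

lemma scale_right_distrib:
  "a \<in> K \<Longrightarrow> x \<in> carrier E \<Longrightarrow> y \<in> carrier E \<Longrightarrow> a \<odot> (x \<oplus> y) = a \<odot> x \<oplus> a \<odot> y"
  using smult_r_distr[of a x y] by (simp add: scalar_field_def)

lemma scale_scale [simp]: "a \<in> K \<Longrightarrow> b \<in> K \<Longrightarrow> x \<in> carrier E \<Longrightarrow> a \<odot> (b \<odot> x) = (a * b) \<odot> x"
  using smult_assoc1[of a b x] by (simp add: scalar_field_def)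

lemma scale_one [simp]: "x \<in> carrier E \<Longrightarrow> 1 \<odot> x = x"
  using smult_one[of x] by (simp add: scalar_field_def)

lemma scale_zero_left [simp]: "x \<in> carrier E \<Longrightarrow> 0 \<odot> x = \<zero>"
  using smult_l_null[of x] by (simp add: scalar_field_def)

lemma scale_zero_right [simp]: "a \<in> K \<Longrightarrow> a \<odot> \<zero> = \<zero>"
  using smult_r_null[of a] by (simp add: scalar_field_def)

lemma minus_eq_scale: "x \<in> carrier E \<Longrightarrow> \<ominus> x = (- 1) \<odot> x"
  using scale_left_distrib[of "-1" 1 x] M.minus_equality[of "(-1) \<odot> x" x] by simp

lemma diff_eq_scale: "x \<in> carrier E \<Longrightarrow> y \<in> carrier E \<Longrightarrow> x \<ominus> y = x \<oplus> (- 1) \<odot> y"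
  by (simp add: M.minus_eq minus_eq_scale)

lemma scale_diff_right:
  "a \<in> K \<Longrightarrow> x \<in> carrier E \<Longrightarrow> y \<in> carrier E \<Longrightarrow> a \<odot> (x \<ominus> y) = a \<odot> x \<ominus> a \<odot> y"
  by (simp add: diff_eq_scale scale_right_distrib)

lemma add_minus_self [simp]: "x \<in> carrier E \<Longrightarrow> x \<oplus> (- 1) \<odot> x = \<zero>"
  by (simp add: M.r_neg flip: minus_eq_scale)

lemma diff_self [simp]: "x \<in> carrier E \<Longrightarrow> x \<ominus> x = \<zero>"
  by (simp add: diff_eq_scale)

lemma diff_zero [simp]: "x \<in> carrier E \<Longrightarrow> x \<ominus> \<zero> = x"
  by (simp add: diff_eq_scale)

lemma add_diff_eq [simp]:
  assumes "x \<in> carrier E" "y \<in> carrier E"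
  shows "x \<oplus> (y \<ominus> x) = y"
proof -
  have "x \<oplus> (y \<oplus> (- 1) \<odot> x) = y \<oplus> (x \<oplus> (- 1) \<odot> x)"
    using assms by (intro M.a_lcomm) auto
  then show ?thesis using assms by (simp add: diff_eq_scale)
qed

lemma diff_add_diff:
  assumes "x \<in> carrier E" "y \<in> carrier E" "z \<in> carrier E"
  shows "(x \<ominus> y) \<oplus> (y \<ominus> z) = x \<ominus> z"
proof -
  have "(x \<ominus> y) \<oplus> (y \<ominus> z) = (x \<ominus> z) \<oplus> (y \<oplus> (-1) \<odot> y)"
    using assms unfolding diff_eq_scale[OF assms(1,2)] diff_eq_scale[OF assms(2,3)] diff_eq_scale[OF assms(1,3)]
    by (simp add: M.a_ac del: add_minus_self)
  then show ?thesis using assms by simp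
qed

lemma diff_diff_cancel:
  assumes "x \<in> carrier E" "y \<in> carrier E" "z \<in> carrier E"
  shows "(x \<ominus> y) \<ominus> (x \<ominus> z) = z \<ominus> y"
proof -
  have "(x \<ominus> y) \<ominus> (x \<ominus> z) = (z \<ominus> y) \<oplus> (x \<oplus> (-1) \<odot> x)"
    using assms by (simp add: diff_eq_scale scale_right_distrib M.a_ac del: add_minus_self)
  then show ?thesis using assms by simp
qed

lemma add_diff_add:
  "x \<in> carrier E \<Longrightarrow> y \<in> carrier E \<Longrightarrow> x' \<in> carrier E \<Longrightarrow> y' \<in> carrier E \<Longrightarrow>
    (x \<oplus> y) \<ominus> (x' \<oplus> y') = (x \<ominus> x') \<oplus> (y \<ominus> y')"
  by (simp add: diff_eq_scale scale_right_distrib M.a_ac)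


subsection \<open>Seminorms\<close>

definition seminorm_on :: "'a set \<Rightarrow> ('a \<Rightarrow> real) \<Rightarrow> bool" where
  "seminorm_on S g \<longleftrightarrow> (\<forall>x\<in>S. 0 \<le> g x) \<and> (\<forall>c\<in>K. \<forall>x\<in>S. g (c \<odot> x) = cmod c * g x) \<and>
     (\<forall>x\<in>S. \<forall>y\<in>S. g (x \<oplus> y) \<le> g x + g y)"

lemma seminorm_onD:
  assumes "seminorm_on S g"
  shows "x \<in> S \<Longrightarrow> 0 \<le> g x"
    and "c \<in> K \<Longrightarrow> x \<in> S \<Longrightarrow> g (c \<odot> x) = cmod c * g x"
    and "x \<in> S \<Longrightarrow> y \<in> S \<Longrightarrow> g (x \<oplus> y) \<le> g x + g y"
  using assms by (auto simp: seminorm_on_def)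

lemma seminorm_zero: "seminorm_on (carrier E) g \<Longrightarrow> g \<zero> = 0"
  using seminorm_onD(2)[of "carrier E" g 0 "\<zero>"] by simp

lemma seminorm_diff:
  assumes g: "seminorm_on (carrier E) g" and xy: "x \<in> carrier E" "y \<in> carrier E"
  shows "g (x \<ominus> y) = g (y \<ominus> x)" "g (x \<ominus> y) \<le> g x + g y" "g x \<le> g (x \<ominus> y) + g y"
proof -
  have "y \<ominus> x = (-1) \<odot> (x \<ominus> y)"
    using xy by (simp add: scale_diff_right) (simp add: diff_eq_scale M.a_comm)
  then show "g (x \<ominus> y) = g (y \<ominus> x)"
    using seminorm_onD(2)[OF g, of "-1" "x \<ominus> y"] xy by simp
  show "g (x \<ominus> y) \<le> g x + g y"
    using seminorm_onD(3)[OF g, of x "(-1) \<odot> y"] seminorm_onD(2)[OF g, of "-1" y] xy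
    by (simp add: diff_eq_scale)
  show "g x \<le> g (x \<ominus> y) + g y"
    using seminorm_onD(3)[OF g, of "x \<ominus> y" y] xy by (simp add: M.a_comm)
qed

lemma seminorm_triangle_diff:
  assumes "seminorm_on (carrier E) g" "x \<in> carrier E" "y \<in> carrier E" "z \<in> carrier E"
  shows "g (x \<ominus> z) \<le> g (x \<ominus> y) + g (y \<ominus> z)"
  using seminorm_onD(3)[OF assms(1), of "x \<ominus> y" "y \<ominus> z"] assms by (simp add: diff_add_diff)


subsection \<open>The Minkowski functional of an absolutely convex set\<close>

definition minkowski :: "'a set \<Rightarrow> 'a \<Rightarrow> real" where
  "minkowski D x = Inf {t. 0 < t \<and> complex_of_real (1 / t) \<odot> x \<in> D}"

definition disc_span :: "'a set \<Rightarrow> 'a set" where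
  "disc_span D = {x \<in> carrier E. \<exists>t>0. complex_of_real (1 / t) \<odot> x \<in> D}"

lemma disc_span_carrier: "x \<in> disc_span D \<Longrightarrow> x \<in> carrier E"
  by (simp add: disc_span_def)

context
  fixes D assumes disc: "abs_convex K E D" and ne: "D \<noteq> {}"
begin

lemma disc_carrier: "x \<in> D \<Longrightarrow> x \<in> carrier E"
  using disc by (auto simp: abs_convex_def)

lemma disc_combine:
  "x \<in> D \<Longrightarrow> y \<in> D \<Longrightarrow> a \<in> K \<Longrightarrow> b \<in> K \<Longrightarrow> cmod a + cmod b \<le> 1 \<Longrightarrow> a \<odot> x \<oplus> b \<odot> y \<in> D"
  using disc by (auto simp: abs_convex_def)

lemma disc_scale: "x \<in> D \<Longrightarrow> a \<in> K \<Longrightarrow> cmod a \<le> 1 \<Longrightarrow> a \<odot> x \<in> D"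
  using disc_combine[of x x a 0] disc_carrier[of x] by simp

lemma zero_in_disc: "\<zero> \<in> D"
  using ne disc_scale[of _ 0] disc_carrier by fastforce

lemma disc_mono:
  assumes "x \<in> carrier E" "complex_of_real (1 / t) \<odot> x \<in> D" "0 < t" "t \<le> s"
  shows "complex_of_real (1 / s) \<odot> x \<in> D"
proof -
  have "complex_of_real (t / s) \<odot> (complex_of_real (1 / t) \<odot> x) \<in> D"
    by (rule disc_scale) (use assms in \<open>auto simp: norm_divide\<close>)
  moreover have "complex_of_real (t / s) * complex_of_real (1 / t) = complex_of_real (1 / s)"
    using assms by simp
  ultimately show ?thesis using assms(1) by simp
qed

lemma minkowski_bdd_below: "bdd_below {t. 0 < t \<and> complex_of_real (1 / t) \<odot> x \<in> D}"
  by (rule bdd_belowI[of _ 0]) auto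

lemma minkowski_le: "0 < t \<Longrightarrow> complex_of_real (1 / t) \<odot> x \<in> D \<Longrightarrow> minkowski D x \<le> t"
  unfolding minkowski_def by (rule cInf_lower[OF _ minkowski_bdd_below]) auto

lemma minkowski_nonneg: "x \<in> disc_span D \<Longrightarrow> 0 \<le> minkowski D x"
  unfolding minkowski_def by (rule cInf_greatest) (auto simp: disc_span_def)

lemma minkowski_less:
  assumes "x \<in> disc_span D" "minkowski D x < t"
  shows "complex_of_real (1 / t) \<odot> x \<in> D"
proof -
  have "{t. 0 < t \<and> complex_of_real (1 / t) \<odot> x \<in> D} \<noteq> {}"
    using assms(1) by (auto simp: disc_span_def)
  then obtain s where "0 < s" "complex_of_real (1 / s) \<odot> x \<in> D" "s < t"
    using assms(2) unfolding minkowski_def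
    by (subst (asm) cInf_less_iff[OF _ minkowski_bdd_below]) auto
  then show ?thesis using disc_mono[of x s t] assms(1) by (simp add: disc_span_carrier)
qed

lemma in_disc_minkowski: "x \<in> D \<Longrightarrow> x \<in> disc_span D \<and> minkowski D x \<le> 1"
  using minkowski_le[of 1 x] disc_carrier[of x] by (auto simp: disc_span_def intro!: exI[of _ 1])

lemma disc_span_scale_aux:
  assumes x: "x \<in> carrier E" and D: "complex_of_real (1 / t) \<odot> x \<in> D"
    and c: "c \<in> K" "c \<noteq> 0" and t: "0 < t"
  shows "complex_of_real (1 / (cmod c * t)) \<odot> (c \<odot> x) \<in> D"
proof -
  have "(c / complex_of_real (cmod c)) \<odot> (complex_of_real (1 / t) \<odot> x) \<in> D"
    by (rule disc_scale) (use D c in \<open>auto simp: norm_divide\<close>)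
  then show ?thesis using x c t by (simp add: mult.commute divide_inverse mult.left_commute)
qed

lemma zero_minkowski: "\<zero> \<in> disc_span D \<and> minkowski D \<zero> = 0"
proof
  show s: "\<zero> \<in> disc_span D" using in_disc_minkowski[OF zero_in_disc] by simp
  have "minkowski D \<zero> \<le> e" if "0 < e" for e
    by (rule minkowski_le[OF that]) (simp add: zero_in_disc)
  then show "minkowski D \<zero> = 0"
    using minkowski_nonneg[OF s] field_le_epsilon[of "minkowski D \<zero>" 0] by force
qed

lemma disc_span_scale: "x \<in> disc_span D \<Longrightarrow> c \<in> K \<Longrightarrow> c \<odot> x \<in> disc_span D"
proof (cases "c = 0")
  case False
  assume x: "x \<in> disc_span D" and c: "c \<in> K"
  then obtain t where "0 < t" "complex_of_real (1 / t) \<odot> x \<in> D" by (auto simp: disc_span_def)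
  then have "complex_of_real (1 / (cmod c * t)) \<odot> (c \<odot> x) \<in> D" "0 < cmod c * t"
    using disc_span_scale_aux[of x t c] x c False by (auto simp: disc_span_carrier)
  then show ?thesis using x c by (auto simp only: disc_span_def scale_closed mem_Collect_eq)
qed (simp add: zero_minkowski disc_span_carrier)

lemma minkowski_scale_le:
  assumes x: "x \<in> disc_span D" and c: "c \<in> K" "c \<noteq> 0"
  shows "minkowski D (c \<odot> x) \<le> cmod c * minkowski D x"
proof (rule field_le_epsilon)
  fix e :: real assume e: "0 < e"
  define t where "t = minkowski D x + e / cmod c"
  have t: "0 < t" "minkowski D x < t"
    using e c minkowski_nonneg[OF x] by (auto simp: t_def add_nonneg_pos)
  have "minkowski D (c \<odot> x) \<le> cmod c * t"
    by (rule minkowski_le)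
       (use t c disc_span_scale_aux[OF disc_span_carrier[OF x] minkowski_less[OF x t(2)] c t(1)] in auto)
  also have "\<dots> = cmod c * minkowski D x + e" using c by (simp add: t_def distrib_left)
  finally show "minkowski D (c \<odot> x) \<le> cmod c * minkowski D x + e" .
qed

lemma minkowski_scale:
  assumes x: "x \<in> disc_span D" and c: "c \<in> K"
  shows "minkowski D (c \<odot> x) = cmod c * minkowski D x"
proof (cases "c = 0")
  case True
  then show ?thesis using zero_minkowski x by (simp add: disc_span_carrier)
next
  case False
  have "minkowski D (inverse c \<odot> (c \<odot> x)) \<le> cmod (inverse c) * minkowski D (c \<odot> x)"
    by (rule minkowski_scale_le) (use False c disc_span_scale[OF x c] in auto)
  then have "cmod c * minkowski D x \<le> minkowski D (c \<odot> x)"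
    using False c x by (simp add: disc_span_carrier norm_divide field_simps)
  then show ?thesis using minkowski_scale_le[OF x c False] by simp
qed

lemma minkowski_add_aux:
  assumes "x \<in> carrier E" "y \<in> carrier E" "0 < s" "0 < t"
    and "complex_of_real (1 / s) \<odot> x \<in> D" "complex_of_real (1 / t) \<odot> y \<in> D"
  shows "complex_of_real (1 / (s + t)) \<odot> (x \<oplus> y) \<in> D"
proof -
  have "complex_of_real (s / (s + t)) \<odot> (complex_of_real (1 / s) \<odot> x) \<oplus>
        complex_of_real (t / (s + t)) \<odot> (complex_of_real (1 / t) \<odot> y) \<in> D"
  proof (rule disc_combine)
    show "cmod (complex_of_real (s / (s + t))) + cmod (complex_of_real (t / (s + t))) \<le> 1"
      using assms by (simp only: norm_of_real) (simp flip: add_divide_distrib)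
  qed (use assms in auto)
  moreover have "complex_of_real (s / (s + t)) * complex_of_real (1 / s) = complex_of_real (1 / (s + t))"
    "complex_of_real (t / (s + t)) * complex_of_real (1 / t) = complex_of_real (1 / (s + t))"
    using assms unfolding of_real_mult[symmetric] by simp_all
  ultimately show ?thesis using assms by (simp add: scale_right_distrib)
qed

lemma disc_span_add:
  assumes "x \<in> disc_span D" "y \<in> disc_span D"
  shows "x \<oplus> y \<in> disc_span D"
proof -
  obtain s t where st: "0 < s" "complex_of_real (1 / s) \<odot> x \<in> D"
    "0 < t" "complex_of_real (1 / t) \<odot> y \<in> D"
    using assms by (auto simp only: disc_span_def mem_Collect_eq)
  then have "0 < s + t \<and> complex_of_real (1 / (s + t)) \<odot> (x \<oplus> y) \<in> D"
    using minkowski_add_aux[of x y s t] assms by (simp add: disc_span_carrier)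
  moreover have "x \<oplus> y \<in> carrier E" using assms by (simp add: disc_span_carrier)
  ultimately show ?thesis unfolding disc_span_def by blast
qed

lemma minkowski_add:
  assumes x: "x \<in> disc_span D" and y: "y \<in> disc_span D"
  shows "minkowski D (x \<oplus> y) \<le> minkowski D x + minkowski D y"
proof (rule field_le_epsilon)
  fix e :: real assume e: "0 < e"
  define s t where "s = minkowski D x + e / 2" and "t = minkowski D y + e / 2"
  have st: "0 < s" "minkowski D x < s" "0 < t" "minkowski D y < t"
    using e minkowski_nonneg[OF x] minkowski_nonneg[OF y] by (auto simp: s_def t_def)
  have "minkowski D (x \<oplus> y) \<le> s + t"
    using st minkowski_le[of "s + t" "x \<oplus> y"] minkowski_add_aux[of x y s t]
      minkowski_less[OF x] minkowski_less[OF y] x y by (simp add: disc_span_carrier)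
  then show "minkowski D (x \<oplus> y) \<le> minkowski D x + minkowski D y + e"
    by (simp add: s_def t_def)
qed

lemma minkowski_seminorm: "seminorm_on (disc_span D) (minkowski D)"
  by (simp add: seminorm_on_def minkowski_nonneg minkowski_scale minkowski_add)

lemma disc_span_diff: "x \<in> disc_span D \<Longrightarrow> y \<in> disc_span D \<Longrightarrow> x \<ominus> y \<in> disc_span D"
  by (simp add: diff_eq_scale disc_span_carrier disc_span_add disc_span_scale)

text \<open>Scaling turns a bound of a seminorm on the disc into a bound by a multiple of the
  Minkowski functional.\<close>
lemma minkowski_bound:
  assumes f: "seminorm_on (carrier E) f" and le: "\<And>x. x \<in> D \<Longrightarrow> f x \<le> M"
    and x: "x \<in> disc_span D"
  shows "f x \<le> M * minkowski D x"
proof -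
  have M: "0 \<le> M" using le[OF zero_in_disc] seminorm_zero[OF f] by simp
  have *: "f x \<le> t * M" if t: "minkowski D x < t" for t
  proof -
    have t0: "0 < t" using t minkowski_nonneg[OF x] by simp
    have "f (complex_of_real (1 / t) \<odot> x) \<le> M" by (rule le[OF minkowski_less[OF x t]])
    moreover have "f x = t * f (complex_of_real (1 / t) \<odot> x)"
      using seminorm_onD(2)[OF f, of "complex_of_real (1/t)" x] x t0
      by (simp add: disc_span_carrier norm_divide)
    ultimately show ?thesis using t0 by simp
  qed
  show ?thesis
  proof (cases "M = 0")
    case True
    then show ?thesis using *[of "minkowski D x + 1"] by simp
  next
    case False
    show ?thesis
    proof (rule field_le_epsilon)
      fix e :: real assume "0 < e"
      then show "f x \<le> M * minkowski D x + e"
        using *[of "minkowski D x + e / M"] False M by (simp add: distrib_left distrib_right mult.commute)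
    qed
  qed
qed

end

end


section \<open>The Hahn-Banach theorem\<close>

context scalar_module
begin

text \<open>The value outside the carrier is fixed so that the pointwise order on sublinear functions is
  antisymmetric.\<close>
definition sublinear :: "('a \<Rightarrow> real) \<Rightarrow> bool" where
  "sublinear q \<longleftrightarrow> (\<forall>x\<in>carrier E. \<forall>y\<in>carrier E. q (x \<oplus> y) \<le> q x + q y) \<and>
     (\<forall>r\<ge>0. \<forall>x\<in>carrier E. q (complex_of_real r \<odot> x) \<le> r * q x) \<and> (\<forall>x. x \<notin> carrier E \<longrightarrow> q x = 0)"

lemma sublinearD:
  assumes "sublinear q"
  shows "x \<in> carrier E \<Longrightarrow> y \<in> carrier E \<Longrightarrow> q (x \<oplus> y) \<le> q x + q y"
    and "0 \<le> r \<Longrightarrow> x \<in> carrier E \<Longrightarrow> q (complex_of_real r \<odot> x) \<le> r * q x"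
    and "x \<notin> carrier E \<Longrightarrow> q x = 0"
  using assms by (auto simp: sublinear_def)

lemma sublinear_zero: "sublinear q \<Longrightarrow> q \<zero> = 0"
  using sublinearD(1)[of q "\<zero>" "\<zero>"] sublinearD(2)[of q 0 "\<zero>"] by simp

lemma sublinear_scale:
  assumes q: "sublinear q" and r: "0 \<le> r" and x: "x \<in> carrier E"
  shows "q (complex_of_real r \<odot> x) = r * q x"
proof (cases "r = 0")
  case True
  then show ?thesis using sublinear_zero[OF q] x by simp
next
  case False
  have "q (complex_of_real (1 / r) \<odot> (complex_of_real r \<odot> x)) \<le> 1 / r * q (complex_of_real r \<odot> x)"
    using r x by (intro sublinearD(2)[OF q]) auto
  then have "r * q x \<le> q (complex_of_real r \<odot> x)"
    using False r x by (simp add: field_simps)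
  then show ?thesis using sublinearD(2)[OF q r x] by simp
qed

lemma sublinear_minus:
  assumes "sublinear q" "x \<in> carrier E"
  shows "- q ((- 1) \<odot> x) \<le> q x"
  using sublinearD(1)[OF assms(1), of x "(- 1) \<odot> x"] sublinear_zero[OF assms(1)] assms(2) by simp

text \<open>This serves two infima: that of a chain of sublinear functions, and that of the family
  \<open>x \<mapsto> q (x + t y) - t q y\<close>, indexed by \<open>t \<ge> 0\<close>.\<close>
lemma sublinear_INF:
  assumes ne: "I \<noteq> {}"
    and bdd: "\<And>x. x \<in> carrier E \<Longrightarrow> bdd_below ((\<lambda>i. f i x) ` I)"
    and add: "\<And>i j x y. i \<in> I \<Longrightarrow> j \<in> I \<Longrightarrow> x \<in> carrier E \<Longrightarrow> y \<in> carrier E \<Longrightarrow>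
      \<exists>k\<in>I. f k (x \<oplus> y) \<le> f i x + f j y"
    and scale: "\<And>i r x. i \<in> I \<Longrightarrow> 0 < r \<Longrightarrow> x \<in> carrier E \<Longrightarrow>
      \<exists>k\<in>I. f k (complex_of_real r \<odot> x) \<le> r * f i x"
    and zero: "\<exists>i\<in>I. f i \<zero> \<le> 0"
  shows "sublinear (\<lambda>x. if x \<in> carrier E then INF i\<in>I. f i x else 0)"
proof -
  let ?u = "\<lambda>x. INF i\<in>I. f i x"
  have low: "?u x \<le> f i x" if "x \<in> carrier E" "i \<in> I" for x i
    using that bdd by (auto intro: cINF_lower)
  have "?u (x \<oplus> y) \<le> ?u x + ?u y" if xy: "x \<in> carrier E" "y \<in> carrier E" for x y
  proof -
    have 1: "?u (x \<oplus> y) \<le> f i x + f j y" if ij: "i \<in> I" "j \<in> I" for i j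
    proof -
      obtain k where "k \<in> I" "f k (x \<oplus> y) \<le> f i x + f j y" using add ij xy by blast
      then show ?thesis using low[of "x \<oplus> y" k] xy by simp
    qed
    have "?u (x \<oplus> y) - f i x \<le> ?u y" if "i \<in> I" for i
      using ne 1[OF that] by (intro cINF_greatest) (auto simp: algebra_simps)
    then have "?u (x \<oplus> y) - ?u y \<le> ?u x"
      using ne by (intro cINF_greatest) (auto simp: algebra_simps)
    then show ?thesis by simp
  qed
  moreover have "?u (complex_of_real r \<odot> x) \<le> r * ?u x" if r: "0 \<le> r" and x: "x \<in> carrier E" for r x
  proof (cases "r = 0")
    case True
    obtain i where "i \<in> I" "f i \<zero> \<le> 0" using zero by blast
    then show ?thesis using low[of "\<zero>" i] True x by simp
  next
    case False
    then have r: "0 < r" using r by simp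
    have "?u (complex_of_real r \<odot> x) / r \<le> f i x" if i: "i \<in> I" for i
    proof -
      obtain k where "k \<in> I" "f k (complex_of_real r \<odot> x) \<le> r * f i x" using scale i r x by blast
      then have "?u (complex_of_real r \<odot> x) \<le> r * f i x"
        using low[of "complex_of_real r \<odot> x" k] x by simp
      then show ?thesis using r by (simp add: field_simps)
    qed
    then have "?u (complex_of_real r \<odot> x) / r \<le> ?u x" using ne by (intro cINF_greatest) auto
    then show ?thesis using r by (simp add: field_simps)
  qed
  ultimately show ?thesis by (simp add: sublinear_def)
qed

text \<open>The witness is \<open>h x = inf {q (x + t y) - t q y | t \<ge> 0}\<close>; the bounds come from \<open>t = 0\<close> and \<open>t = 1\<close>.
  Its value at \<open>- y\<close> is the smallest that sublinearity permits below \<open>q\<close>.\<close>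
lemma sublinear_direction:
  assumes q: "sublinear q" and y: "y \<in> carrier E"
  obtains h where "sublinear h" "h \<le> q" "h ((- 1) \<odot> y) \<le> - q y"
    "\<And>x. x \<in> carrier E \<Longrightarrow> h x \<le> q (x \<oplus> y) - q y"
proof -
  define f where "f t x = q (x \<oplus> complex_of_real t \<odot> y) - t * q y" for t x
  define h where "h x = (if x \<in> carrier E then INF t\<in>{0..}. f t x else 0)" for x
  have low: "- q ((- 1) \<odot> x) \<le> f t x" if "0 \<le> t" "x \<in> carrier E" for t x
  proof -
    have "((- 1) \<odot> x) \<oplus> (x \<oplus> complex_of_real t \<odot> y) = complex_of_real t \<odot> y"
      using that y M.a_assoc[of "(- 1) \<odot> x" x "complex_of_real t \<odot> y"]
      by (simp add: M.a_comm[of "(- 1) \<odot> x" x])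
    then have "t * q y \<le> q ((- 1) \<odot> x) + q (x \<oplus> complex_of_real t \<odot> y)"
      using sublinearD(1)[OF q, of "(- 1) \<odot> x" "x \<oplus> complex_of_real t \<odot> y"] that y
      by (simp add: sublinear_scale[OF q])
    then show ?thesis by (simp add: f_def)
  qed
  have bdd: "bdd_below ((\<lambda>t. f t x) ` {0..})" if "x \<in> carrier E" for x
    using low that by (intro bdd_belowI2[of _ "- q ((- 1) \<odot> x)"]) auto
  have h: "h x \<le> f t x" if "0 \<le> t" "x \<in> carrier E" for t x
    using that bdd unfolding h_def by (auto intro: cINF_lower)
  have "sublinear h"
    unfolding h_def
  proof (rule sublinear_INF[OF _ bdd])
    fix s t x z
    assume st: "s \<in> {0::real..}" "t \<in> {0::real..}" and xz: "x \<in> carrier E" "z \<in> carrier E"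
    have "(x \<oplus> z) \<oplus> complex_of_real (s + t) \<odot> y
      = (x \<oplus> complex_of_real s \<odot> y) \<oplus> (z \<oplus> complex_of_real t \<odot> y)"
      using xz y by (simp add: scale_left_distrib M.a_ac)
    then have "f (s + t) (x \<oplus> z) \<le> f s x + f t z"
      using sublinearD(1)[OF q, of "x \<oplus> complex_of_real s \<odot> y" "z \<oplus> complex_of_real t \<odot> y"] xz y
      by (simp add: f_def algebra_simps)
    then show "\<exists>k\<in>{0..}. f k (x \<oplus> z) \<le> f s x + f t z"
      using st by (intro bexI[of _ "s + t"]) auto
  next
    fix t r x
    assume t: "t \<in> {0::real..}" and r: "0 < (r::real)" and x: "x \<in> carrier E"
    have "complex_of_real r \<odot> x \<oplus> complex_of_real (r * t) \<odot> y
      = complex_of_real r \<odot> (x \<oplus> complex_of_real t \<odot> y)"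
      using x y by (simp add: scale_right_distrib)
    then have "f (r * t) (complex_of_real r \<odot> x) \<le> r * f t x"
      using sublinearD(2)[OF q, of r "x \<oplus> complex_of_real t \<odot> y"] x y r
      by (simp add: f_def algebra_simps)
    then show "\<exists>k\<in>{0..}. f k (complex_of_real r \<odot> x) \<le> r * f t x"
      using t r by (intro bexI[of _ "r * t"]) auto
  qed (use sublinear_zero[OF q] y in \<open>auto simp: f_def intro!: bexI[of _ 0]\<close>)
  moreover have "h x \<le> q x" for x
    using h[of 0 x] y sublinearD(3)[OF q, of x] by (cases "x \<in> carrier E") (auto simp: f_def h_def)
  moreover have "h ((- 1) \<odot> y) \<le> - q y"
    using h[of 1 "(- 1) \<odot> y"] y sublinear_zero[OF q]
    by (simp add: f_def M.a_comm[of "(- 1) \<odot> y" y])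
  moreover have "h x \<le> q (x \<oplus> y) - q y" if "x \<in> carrier E" for x
    using h[of 1 x] that y by (simp add: f_def)
  ultimately show ?thesis using that by (auto simp: le_fun_def)
qed

text \<open>For a minimal \<open>q\<close> the improvement in the direction \<open>y\<close> is \<open>q\<close> itself, which is the missing
  inequality \<open>q x + q y \<le> q (x + y)\<close>.\<close>
lemma minimal_sublinear_additive:
  assumes q: "sublinear q" and min: "\<And>h. sublinear h \<Longrightarrow> h \<le> q \<Longrightarrow> h = q"
    and xy: "x \<in> carrier E" "y \<in> carrier E"
  shows "q (x \<oplus> y) = q x + q y"
proof -
  obtain h where "sublinear h" "h \<le> q" "\<And>x. x \<in> carrier E \<Longrightarrow> h x \<le> q (x \<oplus> y) - q y"
    using sublinear_direction[OF q xy(2)] by metis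
  then have "q x \<le> q (x \<oplus> y) - q y" using min xy by metis
  then show ?thesis using sublinearD(1)[OF q xy] by simp
qed

lemma ex_minimal_sublinear:
  assumes p: "sublinear p"
  obtains q where "sublinear q" "q \<le> p" "\<And>h. sublinear h \<Longrightarrow> h \<le> q \<Longrightarrow> h = q"
proof -
  let ?A = "{q. sublinear q \<and> q \<le> p}" and ?P = "\<lambda>x y. y \<le> (x :: 'a \<Rightarrow> real)"
  have "\<exists>q\<in>?A. \<forall>h\<in>?A. ?P q h \<longrightarrow> h = q"
  proof (rule predicate_Zorn)
    show "partial_order_on ?A (relation_of ?P ?A)"
      by (rule partial_order_on_relation_ofI) auto
  next
    fix C assume C: "C \<in> Chains (relation_of ?P ?A)"
    then have CA: "C \<subseteq> ?A" and chain: "\<And>f g. f \<in> C \<Longrightarrow> g \<in> C \<Longrightarrow> f \<le> g \<or> g \<le> f"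
      by (auto simp: Chains_def relation_of_def)
    show "\<exists>u\<in>?A. \<forall>a\<in>C. ?P a u"
    proof (cases "C = {}")
      case True
      then show ?thesis using p by auto
    next
      case False
      define u where "u x = (if x \<in> carrier E then INF f\<in>C. f x else 0)" for x
      have bdd: "bdd_below ((\<lambda>f. f x) ` C)" if x: "x \<in> carrier E" for x
      proof (rule bdd_belowI2)
        fix f assume "f \<in> C"
        then have f: "sublinear f" "f ((- 1) \<odot> x) \<le> p ((- 1) \<odot> x)" using CA by (auto simp: le_fun_def)
        show "- p ((- 1) \<odot> x) \<le> f x" using f(2) sublinear_minus[OF f(1) x] by simp
      qed
      have "sublinear u"
        unfolding u_def
      proof (rule sublinear_INF[OF False bdd])
        fix f g x y assume fg: "f \<in> C" "g \<in> C" and xy: "x \<in> carrier E" "y \<in> carrier E"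
        have sub: "sublinear f" "sublinear g" using fg CA by auto
        consider "f \<le> g" | "g \<le> f" using chain fg by blast
        then show "\<exists>k\<in>C. k (x \<oplus> y) \<le> f x + g y"
        proof cases
          case 1
          then have "f (x \<oplus> y) \<le> f x + g y"
            using sublinearD(1)[OF sub(1) xy] le_funD[OF 1, of y] by simp
          then show ?thesis using fg by blast
        next
          case 2
          then have "g (x \<oplus> y) \<le> f x + g y"
            using sublinearD(1)[OF sub(2) xy] le_funD[OF 2, of x] by simp
          then show ?thesis using fg by blast
        qed
      next
        fix f r x assume "f \<in> C" "0 < (r::real)" "x \<in> carrier E"
        then show "\<exists>k\<in>C. k (complex_of_real r \<odot> x) \<le> r * f x"
          using CA sublinearD(2)[of f r x] by (intro bexI[of _ f]) auto
      next
        show "\<exists>f\<in>C. f \<zero> \<le> 0" using False CA sublinear_zero by fastforce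
      qed
      moreover have uf: "u \<le> f" if "f \<in> C" for f
      proof (rule le_funI)
        fix x
        have "sublinear f" using that CA by auto
        then show "u x \<le> f x"
          using that bdd[of x] sublinearD(3)[of f x] by (auto simp: u_def intro: cINF_lower2)
      qed
      moreover have "u \<le> p" using False CA uf by (metis (no_types, lifting) all_not_in_conv
          mem_Collect_eq order_trans subsetD)
      ultimately show ?thesis by blast
    qed
  qed
  then obtain q where "q \<in> ?A" and min: "\<forall>h\<in>?A. h \<le> q \<longrightarrow> h = q" by blast
  then show ?thesis using that[of q] by (auto intro: order_trans)
qed

text \<open>Improving \<open>p\<close> in the direction \<open>y\<close> before minimizing forces the value \<open>p y\<close> at \<open>y\<close>.\<close>
lemma Hahn_Banach_real:
  assumes p: "sublinear p" and y: "y \<in> carrier E"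
  obtains f where "\<And>x z. x \<in> carrier E \<Longrightarrow> z \<in> carrier E \<Longrightarrow> f (x \<oplus> z) = f x + f z"
    "\<And>r x. x \<in> carrier E \<Longrightarrow> f (complex_of_real r \<odot> x) = r * f x"
    "\<And>x. f x \<le> p x" "f y = p y"
proof -
  obtain p' where p': "sublinear p'" "p' \<le> p" "p' ((- 1) \<odot> y) \<le> - p y"
    using sublinear_direction[OF p y] by metis
  obtain f where f: "sublinear f" "f \<le> p'" and min: "\<And>h. sublinear h \<Longrightarrow> h \<le> f \<Longrightarrow> h = f"
    using ex_minimal_sublinear[OF p'(1)] by metis
  have add: "f (x \<oplus> z) = f x + f z" if "x \<in> carrier E" "z \<in> carrier E" for x z
    by (rule minimal_sublinear_additive[OF f(1) min that])
  have neg: "f ((- 1) \<odot> x) = - f x" if "x \<in> carrier E" for x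
    using add[of x "(- 1) \<odot> x"] sublinear_zero[OF f(1)] that by simp
  have "f (complex_of_real r \<odot> x) = r * f x" if x: "x \<in> carrier E" for r x
  proof (cases "0 \<le> r")
    case True
    then show ?thesis by (rule sublinear_scale[OF f(1) _ x])
  next
    case False
    then have "f ((- 1) \<odot> (complex_of_real (- r) \<odot> x)) = r * f x"
      using sublinear_scale[OF f(1), of "- r" x] x neg[of "complex_of_real (- r) \<odot> x"] by simp
    then show ?thesis using x by simp
  qed
  moreover have fp: "f x \<le> p x" for x using f(2) p'(2) by (meson le_funD order_trans)
  moreover have "f y = p y"
    using le_funD[OF f(2), of "(- 1) \<odot> y"] p'(3) neg[OF y] fp[of y] by simp
  ultimately show ?thesis using add that by blast
qed

definition linear_functional :: "('a \<Rightarrow> complex) \<Rightarrow> bool" where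
  "linear_functional \<phi> \<longleftrightarrow> (\<forall>x\<in>carrier E. \<phi> x \<in> K) \<and>
     (\<forall>x\<in>carrier E. \<forall>y\<in>carrier E. \<phi> (x \<oplus> y) = \<phi> x + \<phi> y) \<and>
     (\<forall>c\<in>K. \<forall>x\<in>carrier E. \<phi> (c \<odot> x) = c * \<phi> x) \<and> (\<forall>x. x \<notin> carrier E \<longrightarrow> \<phi> x = 0)"

text \<open>Over the complex numbers a real-linear \<open>f\<close> is the real part of \<open>x \<mapsto> f x - \<i> f (\<i> x)\<close>.\<close>
lemma linear_functional_of_real_part:
  assumes add: "\<And>x z. x \<in> carrier E \<Longrightarrow> z \<in> carrier E \<Longrightarrow> f (x \<oplus> z) = f x + f z"
    and scale: "\<And>r x. x \<in> carrier E \<Longrightarrow> f (complex_of_real r \<odot> x) = r * f x"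
  obtains \<phi> where "linear_functional \<phi>" "\<And>x. x \<in> carrier E \<Longrightarrow> Re (\<phi> x) = f x"
proof (cases "K = \<real>")
  case True
  define \<phi> where "\<phi> x = (if x \<in> carrier E then complex_of_real (f x) else 0)" for x
  have "\<phi> (c \<odot> x) = c * \<phi> x" if c: "c \<in> K" and x: "x \<in> carrier E" for c x
  proof -
    obtain r where "c = complex_of_real r" using c True by (auto elim: Reals_cases)
    then show ?thesis using x scale[of x r] by (simp add: \<phi>_def)
  qed
  then have "linear_functional \<phi>"
    using add by (auto simp: linear_functional_def \<phi>_def)
  then show ?thesis using that[of \<phi>] by (simp add: \<phi>_def)
next
  case False
  then have K: "K = UNIV" using K_cases by auto
  define \<phi> where "\<phi> x = (if x \<in> carrier E then Complex (f x) (- f (\<i> \<odot> x)) else 0)" for x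
  have "\<phi> (c \<odot> x) = c * \<phi> x" if x: "x \<in> carrier E" for x c
  proof -
    have "c \<odot> x = complex_of_real (Re c) \<odot> x \<oplus> complex_of_real (Im c) \<odot> (\<i> \<odot> x)"
    proof -
      have "(complex_of_real (Re c) + complex_of_real (Im c) * \<i>) \<odot> x
        = complex_of_real (Re c) \<odot> x \<oplus> (complex_of_real (Im c) * \<i>) \<odot> x"
        by (rule scale_left_distrib) (simp_all add: K x)
      moreover have "complex_of_real (Re c) + complex_of_real (Im c) * \<i> = c"
        by (simp add: complex_eq_iff)
      moreover have "complex_of_real (Im c) \<odot> (\<i> \<odot> x) = (complex_of_real (Im c) * \<i>) \<odot> x"
        by (rule scale_scale) (simp_all add: K x)
      ultimately show ?thesis by (simp only:)
    qed
    then have 1: "f (c \<odot> x) = Re c * f x + Im c * f (\<i> \<odot> x)"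
      using x scale add by (simp add: K del: scale_scale)
    have "\<i> \<odot> (c \<odot> x) = complex_of_real (Re c) \<odot> (\<i> \<odot> x) \<oplus> complex_of_real (- Im c) \<odot> x"
      using x by (simp add: K complex_eq_iff flip: scale_left_distrib)
         (rule arg_cong[where f = "\<lambda>c. c \<odot> x"], simp add: complex_eq_iff)
    then have 2: "f (\<i> \<odot> (c \<odot> x)) = Re c * f (\<i> \<odot> x) - Im c * f x"
      using x scale add by (simp add: K del: scale_scale of_real_minus)
    show ?thesis using 1 2 x by (simp add: K \<phi>_def complex_eq_iff del: scale_scale)
  qed
  moreover have "\<phi> (x \<oplus> y) = \<phi> x + \<phi> y" if "x \<in> carrier E" "y \<in> carrier E" for x y
    using add[of x y] add[of "\<i> \<odot> x" "\<i> \<odot> y"] that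
    by (simp add: \<phi>_def K scale_right_distrib complex_eq_iff)
  moreover have "\<phi> x = 0" if "x \<notin> carrier E" for x using that by (simp add: \<phi>_def)
  ultimately have "linear_functional \<phi>"
    unfolding linear_functional_def by (simp add: K)
  then show ?thesis using that[of \<phi>] by (simp add: \<phi>_def)
qed

text \<open>The bound passes from the real part to the modulus by rotating \<open>\<phi> x\<close> to the positive axis,
  which leaves the seminorm of \<open>x\<close> unchanged.\<close>
theorem Hahn_Banach_seminorm:
  assumes g: "seminorm_on (carrier E) g" and y: "y \<in> carrier E"
  shows "\<exists>\<phi>. linear_functional \<phi> \<and> (\<forall>x\<in>carrier E. cmod (\<phi> x) \<le> g x) \<and> cmod (\<phi> y) = g y"
proof -
  define p where "p x = (if x \<in> carrier E then g x else 0)" for x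
  have "sublinear p"
    using seminorm_onD[OF g] by (auto simp: sublinear_def p_def)
  then obtain f where add: "\<And>x z. x \<in> carrier E \<Longrightarrow> z \<in> carrier E \<Longrightarrow> f (x \<oplus> z) = f x + f z"
    and scale: "\<And>r x. x \<in> carrier E \<Longrightarrow> f (complex_of_real r \<odot> x) = r * f x"
    and le: "\<And>x. f x \<le> p x" and fy: "f y = p y"
    using Hahn_Banach_real[OF _ y] by blast
  obtain \<phi> where \<phi>: "linear_functional \<phi>" and Re: "\<And>x. x \<in> carrier E \<Longrightarrow> Re (\<phi> x) = f x"
    using linear_functional_of_real_part[of f] add scale by blast
  have bound: "cmod (\<phi> x) \<le> g x" if x: "x \<in> carrier E" for x
  proof (cases "\<phi> x = 0")
    case True
    then show ?thesis using seminorm_onD(1)[OF g x] by simp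
  next
    case False
    define c where "c = complex_of_real (cmod (\<phi> x)) / \<phi> x"
    have c: "c \<in> K" "cmod c = 1" "c * \<phi> x = complex_of_real (cmod (\<phi> x))"
      using \<phi> x False by (auto simp: c_def linear_functional_def norm_divide)
    have "cmod (\<phi> x) = Re (\<phi> (c \<odot> x))" using c \<phi> x by (simp add: linear_functional_def)
    also have "\<dots> \<le> g (c \<odot> x)" using Re[of "c \<odot> x"] le[of "c \<odot> x"] c x by (simp add: p_def)
    also have "\<dots> = g x" using seminorm_onD(2)[OF g c(1) x] c by simp
    finally show ?thesis .
  qed
  have "g y \<le> cmod (\<phi> y)"
    using complex_Re_le_cmod[of "\<phi> y"] Re[OF y] fy y by (simp add: p_def)
  then have "cmod (\<phi> y) = g y" using bound[OF y] by simp
  then show ?thesis using \<phi> bound by blast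
qed

end


section \<open>Continuous seminorms on a locally convex space\<close>

locale lcs = locally_convex_space K E + scalar_module K E
  for K :: "complex set" and E :: "'a topvec" (structure)
begin

text \<open>For a seminorm, boundedness on some neighborhood of zero amounts to continuity.\<close>
definition cont_seminorm :: "('a \<Rightarrow> real) \<Rightarrow> bool" where
  "cont_seminorm g \<longleftrightarrow> seminorm_on (carrier E) g \<and> (\<exists>U. zero_nbhd E U \<and> (\<forall>x\<in>U. g x \<le> 1))"

lemma cont_seminorm_seminorm: "cont_seminorm g \<Longrightarrow> seminorm_on (carrier E) g"
  by (simp add: cont_seminorm_def)

lemma openin_carrier: "openin (topol E) W \<Longrightarrow> W \<subseteq> carrier E"
  using openin_subset topspace_eq_carrier by blast

lemma openin_translate:
  assumes "openin (topol E) W" "x \<in> carrier E"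
  shows "openin (topol E) {y \<in> carrier E. x \<oplus> y \<in> W}"
proof -
  have "continuous_map (topol E) (topol E) ((\<lambda>(x, y). x \<oplus> y) \<circ> (\<lambda>y. (x, y)))"
    using assms(2) topspace_eq_carrier
    by (intro continuous_map_compose[OF _ continuous_add] continuous_map_pairedI) auto
  from openin_continuous_map_preimage[OF this assms(1)] show ?thesis
    by (simp add: topspace_eq_carrier)
qed

lemma openin_scale:
  assumes "openin (topol E) W" "c \<in> K"
  shows "openin (topol E) {y \<in> carrier E. c \<odot> y \<in> W}"
proof -
  have "continuous_map (topol E) (topol E) ((\<lambda>(c, x). c \<odot> x) \<circ> (\<lambda>y. (c, y)))"
    using assms(2)
    by (intro continuous_map_compose[OF _ continuous_smult] continuous_map_pairedI) auto
  from openin_continuous_map_preimage[OF this assms(1)] show ?thesis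
    by (simp add: topspace_eq_carrier)
qed

lemma zero_nbhd_scale:
  assumes "zero_nbhd E U" "c \<in> K"
  shows "zero_nbhd E {y \<in> carrier E. c \<odot> y \<in> U}"
proof -
  obtain W where "openin (topol E) W" "\<zero> \<in> W" "W \<subseteq> U" using assms(1) by (auto simp: zero_nbhd_def)
  then show ?thesis
    using openin_scale[of W c] assms(2) unfolding zero_nbhd_def
    by (intro conjI exI[of _ "{y \<in> carrier E. c \<odot> y \<in> W}"]) auto
qed

lemma zero_nbhd_small_scalars:
  assumes "zero_nbhd E C"
  obtains d V where "0 < d" "zero_nbhd E V"
    "\<And>c x. c \<in> K \<Longrightarrow> cmod c < d \<Longrightarrow> x \<in> V \<Longrightarrow> c \<odot> x \<in> C"
proof -
  obtain W where W: "openin (topol E) W" "\<zero> \<in> W" "W \<subseteq> C" using assms by (auto simp: zero_nbhd_def)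
  let ?X = "prod_topology (top_of_set K) (topol E)"
  have "openin ?X {z \<in> topspace ?X. (\<lambda>(c, x). c \<odot> x) z \<in> W}"
    by (rule openin_continuous_map_preimage[OF continuous_smult W(1)])
  moreover have "(0, \<zero>) \<in> {z \<in> topspace ?X. (\<lambda>(c, x). c \<odot> x) z \<in> W}"
    using W(2) by (simp add: topspace_eq_carrier)
  ultimately have "\<exists>S V. openin (top_of_set K) S \<and> openin (topol E) V \<and> 0 \<in> S \<and> \<zero> \<in> V \<and>
    S \<times> V \<subseteq> {z \<in> topspace ?X. (\<lambda>(c, x). c \<odot> x) z \<in> W}"
    unfolding openin_prod_topology_alt by blast
  then obtain S V where SV: "openin (top_of_set K) S" "openin (topol E) V" "0 \<in> S" "\<zero> \<in> V"
    "S \<times> V \<subseteq> {z \<in> topspace ?X. (\<lambda>(c, x). c \<odot> x) z \<in> W}"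
    by blast
  obtain T where T: "open T" "S = K \<inter> T" using SV(1) by (auto simp: openin_open)
  then obtain d where d: "0 < d" "ball 0 d \<subseteq> T" using SV(3) by (auto simp: open_contains_ball)
  show ?thesis
  proof (rule that[OF d(1)])
    show "zero_nbhd E V" using SV openin_carrier by (auto simp: zero_nbhd_def)
    show "c \<odot> x \<in> C" if "c \<in> K" "cmod c < d" "x \<in> V" for c x
      using that SV(5) T d W(3) by (auto simp: mem_ball_0 subset_iff)
  qed
qed

text \<open>The balanced core \<open>D\<close> of a convex neighborhood is absolutely convex, and continuity of the scalar
  multiplication at the origin makes it a neighborhood; its Minkowski functional is the seminorm.\<close>
lemma ex_cont_seminorm:
  assumes "zero_nbhd E U"
  shows "\<exists>g. cont_seminorm g \<and> (\<forall>x\<in>carrier E. g x < 1 \<longrightarrow> x \<in> U)"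
proof -
  obtain C where C: "zero_nbhd E C" "convex_subset E C" "C \<subseteq> U" using locally_convex[OF assms] by blast
  define D where "D = {x \<in> carrier E. \<forall>c\<in>K. cmod c \<le> 1 \<longrightarrow> c \<odot> x \<in> C}"
  obtain d V where d: "0 < d" "zero_nbhd E V"
    and dV: "\<And>c x. c \<in> K \<Longrightarrow> cmod c < d \<Longrightarrow> x \<in> V \<Longrightarrow> c \<odot> x \<in> C"
    using zero_nbhd_small_scalars[OF C(1)] by metis
  define V' where "V' = {x \<in> carrier E. complex_of_real (2 / d) \<odot> x \<in> V}"
  have V': "zero_nbhd E V'" unfolding V'_def by (rule zero_nbhd_scale[OF d(2)]) simp
  have "V' \<subseteq> D"
  proof
    fix x assume x: "x \<in> V'"
    have "c \<odot> x \<in> C" if "c \<in> K" "cmod c \<le> 1" for c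
    proof -
      have "(c * complex_of_real (d / 2)) \<odot> (complex_of_real (2 / d) \<odot> x) \<in> C"
      proof (rule dV)
        have "cmod c * d \<le> 1 * d" using that d(1) by (intro mult_right_mono) auto
        then show "cmod (c * complex_of_real (d / 2)) < d" using d(1) by (simp add: norm_mult)
        show "c * complex_of_real (d / 2) \<in> K" using that by (intro K_closed of_real_K)
      qed (use x in \<open>simp add: V'_def\<close>)
      moreover have "c * complex_of_real (d / 2) * complex_of_real (2 / d) = c" using d(1) by simp
      moreover have "(c * complex_of_real (d / 2)) \<odot> (complex_of_real (2 / d) \<odot> x)
        = (c * complex_of_real (d / 2) * complex_of_real (2 / d)) \<odot> x"
        using x that by (intro scale_scale K_closed of_real_K) (simp_all add: V'_def)
      ultimately show ?thesis by simp
    qed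
    then show "x \<in> D" using x by (auto simp: D_def V'_def)
  qed
  then have D: "zero_nbhd E D" using V' unfolding zero_nbhd_def D_def by blast
  have disc: "abs_convex K E D"
    unfolding abs_convex_def
  proof (intro conjI ballI impI)
    show "D \<subseteq> carrier E" by (auto simp: D_def)
    fix x y a b assume xy: "x \<in> D" "y \<in> D" and ab: "a \<in> K" "b \<in> K" "cmod a + cmod b \<le> 1"
    have xyE: "x \<in> carrier E" "y \<in> carrier E" using xy by (auto simp: D_def)
    have "c \<odot> (a \<odot> x \<oplus> b \<odot> y) \<in> C" if c: "c \<in> K" "cmod c \<le> 1" for c
    proof -
      \<comment> \<open>The convex combination has the weights \<open>1 - t\<close> and \<open>t\<close>; if one of them is zero, so is the
        corresponding coefficient, and division by zero yields zero.\<close>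
      define t where "t = cmod b"
      have t: "0 \<le> t" "t \<le> 1" "cmod a \<le> 1 - t" using ab(3) order_trans[OF le_add_same_cancel2[THEN iffD2, OF norm_ge_zero] ab(3)]
        by (simp_all add: t_def)
      have ca: "cmod (c * a) \<le> 1 - t" "cmod (c * b) \<le> t"
        using mult_mono[OF c(2) t(3)] mult_right_mono[OF c(2), of "cmod b"] t
        by (auto simp: norm_mult t_def)
      define u where "u = (c * a / complex_of_real (1 - t)) \<odot> x"
      define v where "v = (c * b / complex_of_real t) \<odot> y"
      have "cmod (c * a / complex_of_real (1 - t)) \<le> 1" "cmod (c * b / complex_of_real t) \<le> 1"
        unfolding norm_divide norm_of_real using ca t by (auto intro!: divide_le_eq_1[THEN iffD2])
      then have uv: "u \<in> C" "v \<in> C" using xy c ab unfolding u_def v_def D_def by simp_all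
      have "complex_of_real (1 - t) \<odot> u \<oplus> complex_of_real t \<odot> v \<in> C"
        using C(2) uv t unfolding convex_subset_def by auto
      moreover have "complex_of_real (1 - t) * (c * a / complex_of_real (1 - t)) = c * a"
        "complex_of_real t * (c * b / complex_of_real t) = c * b"
        using ca by auto
      ultimately show ?thesis using xyE ab c
        by (simp add: u_def v_def scale_right_distrib del: of_real_diff times_divide_eq_right)
    qed
    then show "a \<odot> x \<oplus> b \<odot> y \<in> D" using xyE ab by (simp add: D_def)
  qed
  have ne: "D \<noteq> {}" using D by (auto simp: zero_nbhd_def)
  \<comment> \<open>A neighborhood of zero is absorbing, as \<open>c \<mapsto> c \<odot> x\<close> is continuous at zero.\<close>
  have span: "disc_span D = carrier E"
  proof -
    have "x \<in> disc_span D" if x: "x \<in> carrier E" for x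
    proof -
      define h where "h = (\<lambda>c. c \<odot> x)"
      have "continuous_map (top_of_set K) (topol E) ((\<lambda>(c, x). c \<odot> x) \<circ> (\<lambda>c. (c, x)))"
        using x topspace_eq_carrier
        by (intro continuous_map_compose[OF _ continuous_smult] continuous_map_pairedI) auto
      moreover obtain W where W: "openin (topol E) W" "\<zero> \<in> W" "W \<subseteq> D"
        using D by (auto simp: zero_nbhd_def)
      ultimately have "openin (top_of_set K) {c \<in> K. c \<odot> x \<in> W}"
        using openin_continuous_map_preimage by fastforce
      then obtain T where T: "open T" "{c \<in> K. c \<odot> x \<in> W} = K \<inter> T" by (auto simp: openin_open)
      have "0 \<in> {c \<in> K. c \<odot> x \<in> W}" using W(2) x by simp
      then have "0 \<in> T" unfolding T(2) by simp
      then obtain e where e: "0 < e" "ball 0 e \<subseteq> T" using T(1) by (auto simp: open_contains_ball)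
      have "complex_of_real (e / 2) \<in> K \<inter> T" using e by (auto simp: mem_ball_0 subset_iff)
      then have "complex_of_real (e / 2) \<odot> x \<in> D" using W(3) unfolding T(2)[symmetric] by blast
      then show ?thesis using e x unfolding disc_span_def by (auto intro!: exI[of _ "2 / e"])
    qed
    then show ?thesis by (auto simp: disc_span_def)
  qed
  have "seminorm_on (carrier E) (minkowski D)"
    using minkowski_seminorm[OF disc ne] span by simp
  then have "cont_seminorm (minkowski D)"
    using D in_disc_minkowski[OF disc ne] by (auto simp: cont_seminorm_def)
  moreover have "x \<in> U" if x: "x \<in> carrier E" "minkowski D x < 1" for x
  proof -
    have "x \<in> D" using minkowski_less[OF disc ne, of x 1] x span by simp
    then have "1 \<odot> x \<in> C" unfolding D_def using K_closed(1) by fastforce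
    then show ?thesis using C(3) x by auto
  qed
  ultimately show ?thesis by blast
qed

lemma cont_seminorm_scale:
  assumes g: "cont_seminorm g" and r: "0 \<le> r"
  shows "cont_seminorm (\<lambda>x. r * g x)"
proof -
  note gs = cont_seminorm_seminorm[OF g]
  obtain U where U: "zero_nbhd E U" "\<And>x. x \<in> U \<Longrightarrow> g x \<le> 1" using g by (auto simp: cont_seminorm_def)
  let ?V = "{x \<in> carrier E. complex_of_real r \<odot> x \<in> U}"
  have "zero_nbhd E ?V" by (rule zero_nbhd_scale[OF U(1)]) simp
  moreover have "r * g x \<le> 1" if "x \<in> ?V" for x
    using that U(2)[of "complex_of_real r \<odot> x"] seminorm_onD(2)[OF gs, of "complex_of_real r" x] r by simp
  moreover have "seminorm_on (carrier E) (\<lambda>x. r * g x)"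
    using seminorm_onD[OF gs] r
    by (auto simp: seminorm_on_def mult_left_mono simp flip: distrib_left)
  ultimately show ?thesis unfolding cont_seminorm_def by blast
qed

text \<open>Translation by \<open>x\<close> carries neighborhoods of zero, which contain seminorm balls, to
  neighborhoods of \<open>x\<close>.\<close>
lemma openin_iff_seminorm:
  "openin (topol E) W \<longleftrightarrow> W \<subseteq> carrier E \<and>
     (\<forall>x\<in>W. \<exists>g. cont_seminorm g \<and> (\<forall>y\<in>carrier E. g (y \<ominus> x) < 1 \<longrightarrow> y \<in> W))"
proof (intro iffI conjI ballI)
  assume W: "openin (topol E) W"
  show "W \<subseteq> carrier E" by (rule openin_carrier[OF W])
  fix x assume "x \<in> W"
  then have x: "x \<in> carrier E" "x \<in> W" using openin_carrier[OF W] by auto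
  have "zero_nbhd E {y \<in> carrier E. x \<oplus> y \<in> W}"
    using openin_translate[OF W x(1)] x by (auto simp: zero_nbhd_def)
  then obtain g where g: "cont_seminorm g"
    "\<And>y. y \<in> carrier E \<Longrightarrow> g y < 1 \<Longrightarrow> y \<in> {y \<in> carrier E. x \<oplus> y \<in> W}"
    by (blast dest: ex_cont_seminorm)
  have "y \<in> W" if "y \<in> carrier E" "g (y \<ominus> x) < 1" for y
    using g(2)[of "y \<ominus> x"] that x by auto
  then show "\<exists>g. cont_seminorm g \<and> (\<forall>y\<in>carrier E. g (y \<ominus> x) < 1 \<longrightarrow> y \<in> W)" using g(1) by blast
next
  assume R: "W \<subseteq> carrier E \<and>
    (\<forall>x\<in>W. \<exists>g. cont_seminorm g \<and> (\<forall>y\<in>carrier E. g (y \<ominus> x) < 1 \<longrightarrow> y \<in> W))"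
  show "openin (topol E) W"
  proof (subst openin_subopen, intro ballI)
    fix x assume x: "x \<in> W"
    then have xE: "x \<in> carrier E" using R by auto
    obtain g where g: "cont_seminorm g" "\<And>y. y \<in> carrier E \<Longrightarrow> g (y \<ominus> x) < 1 \<Longrightarrow> y \<in> W"
      using R x by blast
    have "cont_seminorm (\<lambda>x. 2 * g x)" by (rule cont_seminorm_scale[OF g(1)]) simp
    then obtain U where U: "zero_nbhd E U" "\<And>y. y \<in> U \<Longrightarrow> 2 * g y \<le> 1"
      by (auto simp: cont_seminorm_def)
    then obtain U' where U': "openin (topol E) U'" "\<zero> \<in> U'" "U' \<subseteq> U" by (auto simp: zero_nbhd_def)
    let ?T = "{y \<in> carrier E. (- 1) \<odot> x \<oplus> y \<in> U'}"
    have "openin (topol E) ?T" using openin_translate[OF U'(1), of "(- 1) \<odot> x"] xE by simp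
    moreover have "x \<in> ?T" using U'(2) xE by (simp add: M.a_comm[of "(- 1) \<odot> x" x])
    moreover have "?T \<subseteq> W"
    proof
      fix y assume y: "y \<in> ?T"
      then have "y \<ominus> x \<in> U" using U'(3) xE by (auto simp: diff_eq_scale M.a_comm)
      then show "y \<in> W" using U(2)[of "y \<ominus> x"] g(2)[of y] y by simp
    qed
    ultimately show "\<exists>T. openin (topol E) T \<and> x \<in> T \<and> T \<subseteq> W" by blast
  qed
qed

lemma openin_seminorm_ball:
  assumes g: "cont_seminorm g" and x: "x \<in> carrier E"
  shows "openin (topol E) {y \<in> carrier E. g (y \<ominus> x) < 1}"
  unfolding openin_iff_seminorm
proof (intro conjI ballI)
  fix y assume y: "y \<in> {y \<in> carrier E. g (y \<ominus> x) < 1}"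
  define e where "e = 1 - g (y \<ominus> x)"
  have e: "0 < e" using y by (simp add: e_def)
  have "g (z \<ominus> x) < 1" if z: "z \<in> carrier E" "1 / e * g (z \<ominus> y) < 1" for z
  proof -
    have "g (z \<ominus> y) < e" using z(2) e by (simp add: divide_simps)
    then show ?thesis
      using seminorm_triangle_diff[OF cont_seminorm_seminorm[OF g], of z y x] z(1) x y
      by (simp add: e_def)
  qed
  moreover have "cont_seminorm (\<lambda>z. 1 / e * g z)"
    by (rule cont_seminorm_scale[OF g]) (use e in simp)
  ultimately show "\<exists>f. cont_seminorm f \<and>
      (\<forall>z\<in>carrier E. f (z \<ominus> y) < 1 \<longrightarrow> z \<in> {y \<in> carrier E. g (y \<ominus> x) < 1})"
    by (intro exI[of _ "\<lambda>z. 1 / e * g z"]) simp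
qed simp

lemma seminorm_separates:
  assumes x: "x \<in> carrier E" and g: "\<And>g. cont_seminorm g \<Longrightarrow> g x = 0"
  shows "x = \<zero>"
proof (rule ccontr)
  assume "x \<noteq> \<zero>"
  then obtain W where W: "openin (topol E) W" "\<zero> \<in> W" "x \<notin> W"
    using Hausdorff x M.zero_closed unfolding Hausdorff_space_def topspace_eq_carrier disjnt_def
    by (metis disjoint_iff)
  then obtain g where "cont_seminorm g" "\<forall>y\<in>carrier E. g (y \<ominus> \<zero>) < 1 \<longrightarrow> y \<in> W"
    unfolding openin_iff_seminorm by blast
  then show False using g[of g] W(3) x by auto
qed

lemma bounded_iff_seminorm:
  "bounded_subset E B \<longleftrightarrow> B \<subseteq> carrier E \<and> (\<forall>g. cont_seminorm g \<longrightarrow> (\<exists>r>0. \<forall>x\<in>B. g x \<le> r))"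
proof (intro iffI conjI allI impI)
  assume B: "bounded_subset E B"
  show "B \<subseteq> carrier E" using B by (simp add: bounded_subset_def)
  fix g assume g: "cont_seminorm g"
  note gs = cont_seminorm_seminorm[OF g]
  obtain U where U: "zero_nbhd E U" "\<And>x. x \<in> U \<Longrightarrow> g x \<le> 1" using g by (auto simp: cont_seminorm_def)
  then obtain r where r: "0 < r" "B \<subseteq> (\<lambda>x. complex_of_real r \<odot> x) ` U"
    using B unfolding bounded_subset_def by blast
  have "g x \<le> r" if x: "x \<in> B" for x
  proof -
    obtain u where u: "u \<in> U" "x = complex_of_real r \<odot> u" using r x by blast
    have "u \<in> carrier E" using u(1) U(1) by (auto simp: zero_nbhd_def)
    then show ?thesis
      using seminorm_onD(2)[OF gs, of "complex_of_real r" u] U(2)[OF u(1)] r(1) u(2) by simp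
  qed
  then show "\<exists>r>0. \<forall>x\<in>B. g x \<le> r" using r(1) by blast
next
  assume B: "B \<subseteq> carrier E \<and> (\<forall>g. cont_seminorm g \<longrightarrow> (\<exists>r>0. \<forall>x\<in>B. g x \<le> r))"
  show "bounded_subset E B"
    unfolding bounded_subset_def
  proof (intro conjI allI impI)
    show "B \<subseteq> carrier E" using B by simp
    fix U assume U: "zero_nbhd E U"
    obtain g where g: "cont_seminorm g" "\<And>x. x \<in> carrier E \<Longrightarrow> g x < 1 \<Longrightarrow> x \<in> U"
      using ex_cont_seminorm[OF U] by blast
    obtain r where r: "0 < r" "\<And>x. x \<in> B \<Longrightarrow> g x \<le> r" using B g(1) by blast
    have "x \<in> (\<lambda>x. complex_of_real (2 * r) \<odot> x) ` U" if x: "x \<in> B" for x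
    proof -
      have xE: "x \<in> carrier E" using x B by blast
      have "g (complex_of_real (1 / (2 * r)) \<odot> x) < 1"
        using seminorm_onD(2)[OF cont_seminorm_seminorm[OF g(1)], of "complex_of_real (1 / (2 * r))" x]
          xE r(1) r(2)[OF x] by (simp add: norm_divide norm_mult)
      then have "complex_of_real (1 / (2 * r)) \<odot> x \<in> U" using g(2) xE by simp
      moreover have "x = complex_of_real (2 * r) \<odot> (complex_of_real (1 / (2 * r)) \<odot> x)"
        using xE r(1) by (simp add: scale_scale del: of_real_divide of_real_mult flip: of_real_mult)
      ultimately show ?thesis by blast
    qed
    then show "\<exists>r>0. B \<subseteq> (\<lambda>x. complex_of_real r \<odot> x) ` U"
      using r(1) by (intro exI[of _ "2 * r"]) auto
  qed
qed

lemma closedin_seminorm_le: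
  assumes g: "cont_seminorm g"
  shows "closedin (topol E) {x \<in> carrier E. g x \<le> s}"
proof -
  note gs = cont_seminorm_seminorm[OF g]
  have "openin (topol E) {x \<in> carrier E. s < g x}"
    unfolding openin_iff_seminorm
  proof (intro conjI ballI)
    fix x assume "x \<in> {x \<in> carrier E. s < g x}"
    then have x: "x \<in> carrier E" "s < g x" by auto
    let ?f = "\<lambda>y. 1 / (g x - s) * g y"
    have "s < g y" if "y \<in> carrier E" "?f (y \<ominus> x) < 1" for y
      using that seminorm_diff(1,3)[OF gs x(1) that(1)] x by (simp add: divide_simps)
    moreover have "cont_seminorm ?f" by (rule cont_seminorm_scale[OF g]) (use x in auto)
    ultimately show "\<exists>f. cont_seminorm f \<and>
        (\<forall>y\<in>carrier E. f (y \<ominus> x) < 1 \<longrightarrow> y \<in> {x \<in> carrier E. s < g x})"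
      by (intro exI[of _ ?f]) auto
  qed auto
  moreover have "carrier E - {x \<in> carrier E. g x \<le> s} = {x \<in> carrier E. s < g x}" by auto
  ultimately show ?thesis by (simp add: closedin_def topspace_eq_carrier)
qed

lemma abs_convex_seminorm_le:
  assumes g: "seminorm_on (carrier E) g" and s: "0 \<le> s"
  shows "abs_convex K E {x \<in> carrier E. g x \<le> s}"
  unfolding abs_convex_def
proof (intro conjI ballI impI)
  fix x y a b
  assume xy: "x \<in> {x \<in> carrier E. g x \<le> s}" "y \<in> {x \<in> carrier E. g x \<le> s}"
    and ab: "a \<in> K" "b \<in> K" "cmod a + cmod b \<le> 1"
  have "g (a \<odot> x \<oplus> b \<odot> y) \<le> cmod a * g x + cmod b * g y"
    using seminorm_onD(3)[OF g, of "a \<odot> x" "b \<odot> y"] seminorm_onD(2)[OF g] xy ab by simp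
  also have "\<dots> \<le> cmod a * s + cmod b * s" using xy by (intro add_mono mult_left_mono) auto
  also have "\<dots> \<le> s" using mult_right_mono[OF ab(3) s] by (simp add: distrib_right)
  finally show "a \<odot> x \<oplus> b \<odot> y \<in> {x \<in> carrier E. g x \<le> s}" using xy ab by simp
qed auto

lemma closedin_approx:
  assumes D: "closedin (topol E) D" and v: "v \<in> carrier E"
    and approx: "\<And>g. cont_seminorm g \<Longrightarrow> \<exists>d\<in>D. g (d \<ominus> v) < 1"
  shows "v \<in> D"
proof (rule ccontr)
  assume "v \<notin> D"
  have op: "openin (topol E) (carrier E - D)" using D by (simp add: closedin_def topspace_eq_carrier)
  have "v \<in> carrier E - D" using v \<open>v \<notin> D\<close> by simp
  then obtain g where g: "cont_seminorm g"
    "\<And>y. y \<in> carrier E \<Longrightarrow> g (y \<ominus> v) < 1 \<Longrightarrow> y \<in> carrier E - D"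
    using openin_iff_seminorm[THEN iffD1, OF op] by blast
  obtain d where d: "d \<in> D" "g (d \<ominus> v) < 1" using approx[OF g(1)] by blast
  have "d \<in> carrier E" using D d(1) closedin_subset topspace_eq_carrier by blast
  then show False using g(2)[OF _ d(2)] d(1) by simp
qed


subsection \<open>The dual space\<close>

lemma dual_continuous: "\<phi> \<in> dual K E \<Longrightarrow> continuous_map (topol E) (top_of_set K) \<phi>"
  by (simp add: dual_def operator_def scalar_field_def)

lemma dual_linear_functional:
  assumes "\<phi> \<in> dual K E"
  shows "linear_functional \<phi>"
proof -
  have "\<phi> x \<in> K" if "x \<in> carrier E" for x
    using continuous_map_image_subset_topspace[OF dual_continuous[OF assms]] that
    by (auto simp: topspace_eq_carrier)
  then show ?thesis
    using assms by (simp add: dual_def operator_def scalar_field_def linear_functional_def)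
qed

lemma in_dual_if_bounded:
  assumes \<phi>: "linear_functional \<phi>" and g: "cont_seminorm g"
    and le: "\<And>x. x \<in> carrier E \<Longrightarrow> cmod (\<phi> x) \<le> g x"
  shows "\<phi> \<in> dual K E"
proof -
  have diff: "\<phi> (x \<ominus> y) = \<phi> x - \<phi> y" if "x \<in> carrier E" "y \<in> carrier E" for x y
    using \<phi> that by (simp add: linear_functional_def diff_eq_scale)
  have "openin (topol E) {x \<in> carrier E. \<phi> x \<in> T}" if T: "open T" for T
    unfolding openin_iff_seminorm
  proof (intro conjI ballI)
    fix x assume x: "x \<in> {x \<in> carrier E. \<phi> x \<in> T}"
    then obtain e where e: "0 < e" "ball (\<phi> x) e \<subseteq> T" using T by (auto simp: open_contains_ball)
    have "\<phi> y \<in> T" if y: "y \<in> carrier E" "1 / e * g (y \<ominus> x) < 1" for y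
    proof -
      have "cmod (\<phi> y - \<phi> x) < e"
        using le[of "y \<ominus> x"] diff[of y x] y x e(1) by (simp add: divide_simps)
      then show ?thesis using e(2) by (auto simp: subset_iff dist_norm norm_minus_commute)
    qed
    moreover have "cont_seminorm (\<lambda>y. 1 / e * g y)"
      by (rule cont_seminorm_scale[OF g]) (use e in auto)
    ultimately show "\<exists>g. cont_seminorm g \<and>
        (\<forall>y\<in>carrier E. g (y \<ominus> x) < 1 \<longrightarrow> y \<in> {x \<in> carrier E. \<phi> x \<in> T})"
      by (intro exI[of _ "\<lambda>y. 1 / e * g y"]) auto
  qed auto
  then have "continuous_map (topol E) euclidean \<phi>"
    by (auto simp: continuous_map_def topspace_eq_carrier)
  then show ?thesis using \<phi>
    by (auto simp: dual_def operator_def scalar_field_def linear_functional_def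
        continuous_map_in_subtopology topspace_eq_carrier)
qed

lemma dual_cont_seminorm:
  assumes "\<phi> \<in> dual K E"
  shows "cont_seminorm (\<lambda>x. cmod (\<phi> x))"
proof -
  have lin: "linear_functional \<phi>" by (rule dual_linear_functional[OF assms])
  have "continuous_map (topol E) euclidean \<phi>"
    using dual_continuous[OF assms] by (simp add: continuous_map_in_subtopology)
  then have "openin (topol E) {x \<in> carrier E. \<phi> x \<in> ball 0 1}"
    using openin_continuous_map_preimage[of "topol E" euclidean \<phi> "ball 0 1"]
    by (simp add: topspace_eq_carrier)
  moreover have "\<phi> \<zero> = 0"
  proof -
    have "\<phi> (0 \<odot> \<zero>) = 0 * \<phi> \<zero>"
      using lin K_closed(2) M.zero_closed unfolding linear_functional_def by blast
    then show ?thesis by simp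
  qed
  ultimately have "zero_nbhd E {x \<in> carrier E. \<phi> x \<in> ball 0 1}" by (auto simp: zero_nbhd_def)
  moreover have "seminorm_on (carrier E) (\<lambda>x. cmod (\<phi> x))"
    using lin by (auto simp: seminorm_on_def linear_functional_def norm_mult norm_triangle_ineq)
  ultimately show ?thesis
    unfolding cont_seminorm_def
    by (intro conjI exI[of _ "{x \<in> carrier E. \<phi> x \<in> ball 0 1}"]) auto
qed

lemma dual_scale:
  assumes "\<phi> \<in> dual K E" "c \<in> K"
  shows "(\<lambda>x. c * \<phi> x) \<in> dual K E"
proof (rule in_dual_if_bounded)
  show "linear_functional (\<lambda>x. c * \<phi> x)"
    using dual_linear_functional[OF assms(1)] assms(2)
    by (auto simp: linear_functional_def distrib_left mult.left_commute)
  show "cont_seminorm (\<lambda>x. cmod c * cmod (\<phi> x))"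
    by (rule cont_seminorm_scale[OF dual_cont_seminorm[OF assms(1)]]) simp
qed (simp add: norm_mult)

lemma bounded_subset_Un:
  assumes A: "bounded_subset E A" and B: "bounded_subset E B"
  shows "bounded_subset E (A \<union> B)"
  unfolding bounded_iff_seminorm
proof (intro conjI allI impI)
  show "A \<union> B \<subseteq> carrier E" using A B by (simp add: bounded_subset_def)
  fix g assume g: "cont_seminorm g"
  obtain r where "0 < r" "\<forall>x\<in>A. g x \<le> r" using A g unfolding bounded_iff_seminorm by blast
  moreover obtain s where "\<forall>x\<in>B. g x \<le> s" using B g unfolding bounded_iff_seminorm by blast
  ultimately show "\<exists>r>0. \<forall>x\<in>A \<union> B. g x \<le> r"
    by (intro exI[of _ "max r s"]) (auto simp: le_max_iff_disj)
qed

lemma bounded_subset_empty: "bounded_subset E {}"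
  by (auto simp: bounded_iff_seminorm intro: exI[of _ 1])

text \<open>The subbasic sets are balls around arbitrary centers \<open>\<phi>\<close>. One that contains zero contains a
  ball around zero, and finite intersections are handled by uniting the bounded sets.\<close>
lemma strong_topology_zero_nbhd:
  assumes "openin (strong_topology K E) W" "(\<lambda>x. 0) \<in> W"
  shows "\<exists>B e. bounded_subset E B \<and> 0 < e \<and>
    (\<forall>\<psi>\<in>dual K E. (\<forall>x\<in>B. cmod (\<psi> x) \<le> e) \<longrightarrow> \<psi> \<in> W)"
proof -
  let ?G = "{{\<psi> \<in> dual K E. \<exists>d<e. \<forall>x\<in>B. cmod (\<psi> x - \<phi> x) \<le> d} | \<phi> B e.
        \<phi> \<in> dual K E \<and> bounded_subset E B \<and> 0 < e}"
  have "generate_topology_on ?G W"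
    using assms(1) by (simp add: strong_topology_def openin_topology_generated_by_iff)
  then show ?thesis
    using assms(2)
  proof (induction rule: generate_topology_on.induct)
    case Empty
    then show ?case by simp
  next
    case (Int a b)
    obtain A d where A: "bounded_subset E A" "0 < (d::real)"
      "\<forall>\<psi>\<in>dual K E. (\<forall>x\<in>A. cmod (\<psi> x) \<le> d) \<longrightarrow> \<psi> \<in> a" using Int by auto
    obtain B e where B: "bounded_subset E B" "0 < (e::real)"
      "\<forall>\<psi>\<in>dual K E. (\<forall>x\<in>B. cmod (\<psi> x) \<le> e) \<longrightarrow> \<psi> \<in> b" using Int by auto
    have "\<psi> \<in> a \<inter> b" if "\<psi> \<in> dual K E" "\<forall>x\<in>A \<union> B. cmod (\<psi> x) \<le> min d e" for \<psi>
      using that A(3)[rule_format, of \<psi>] B(3)[rule_format, of \<psi>] by simp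
    then show ?case
      using bounded_subset_Un[OF A(1) B(1)] A(2) B(2)
      by (intro exI[of _ "A \<union> B"] exI[of _ "min d e"]) simp
  next
    case (UN S)
    then obtain k where k: "k \<in> S" "(\<lambda>x. 0) \<in> k" by auto
    then obtain B e where "bounded_subset E B" "0 < (e::real)"
      "\<forall>\<psi>\<in>dual K E. (\<forall>x\<in>B. cmod (\<psi> x) \<le> e) \<longrightarrow> \<psi> \<in> k" using UN.IH[OF k(1)] by auto
    then show ?case using k(1) by blast
  next
    case (Basis s)
    then obtain \<phi> B e where s: "s = {\<psi> \<in> dual K E. \<exists>d<e. \<forall>x\<in>B. cmod (\<psi> x - \<phi> x) \<le> d}"
      and B: "bounded_subset E B" "0 < e" by blast
    obtain d where d: "d < e" "\<forall>x\<in>B. cmod (\<phi> x) \<le> d" using Basis.prems s by auto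
    have "\<psi> \<in> s" if \<psi>: "\<psi> \<in> dual K E" "\<forall>x\<in>B. cmod (\<psi> x) \<le> (e - d) / 2" for \<psi>
    proof -
      have "\<forall>x\<in>B. cmod (\<psi> x - \<phi> x) \<le> (e - d) / 2 + d"
        using \<psi>(2) d(2) by (intro ballI order_trans[OF norm_triangle_ineq4] add_mono) auto
      moreover have "(e - d) / 2 + d < e" using d(1) by (simp add: field_simps)
      ultimately show ?thesis using \<psi>(1) s by blast
    qed
    then show ?case using B d(1) by (intro exI[of _ B] exI[of _ "(e - d) / 2"]) auto
  qed
qed

lemma strong_dual_simps [simp]:
  "carrier (strong_dual K E) = dual K E" "topol (strong_dual K E) = strong_topology K E"
  "c \<odot>\<^bsub>strong_dual K E\<^esub> \<phi> = (\<lambda>x. c * \<phi> x)"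
  by (simp_all add: strong_dual_def)

text \<open>Polars of neighborhoods are strongly bounded, so a strongly continuous functional is bounded on
  them.\<close>
lemma bidual_bound:
  assumes f: "f \<in> dual K (strong_dual K E)" and g: "cont_seminorm g"
  shows "\<exists>C\<ge>0. \<forall>\<phi>\<in>dual K E. \<forall>r>0. (\<forall>x\<in>carrier E. cmod (\<phi> x) \<le> r * g x) \<longrightarrow> cmod (f \<phi>) \<le> C * r"
proof -
  have scale: "f (\<lambda>x. c * \<phi> x) = c * f \<phi>" if "c \<in> K" "\<phi> \<in> dual K E" for c \<phi>
    using f that by (simp add: dual_def[of K "strong_dual K E"] operator_def scalar_field_def)
  have zero: "(\<lambda>x. 0) \<in> dual K E"
    by (rule in_dual_if_bounded[OF _ g])
       (use seminorm_onD(1)[OF cont_seminorm_seminorm[OF g]] in \<open>auto simp: linear_functional_def\<close>)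
  have top: "topspace (strong_topology K E) = dual K E"
  proof -
    let ?G = "{{\<psi> \<in> dual K E. \<exists>d<e. \<forall>x\<in>B. cmod (\<psi> x - \<phi> x) \<le> d} | \<phi> B e.
        \<phi> \<in> dual K E \<and> bounded_subset E B \<and> 0 < e}"
    have "{\<psi> \<in> dual K E. \<exists>d<1. \<forall>x\<in>{}. cmod (\<psi> x - 0) \<le> d} \<in> ?G"
      by (intro CollectI exI[of _ "\<lambda>x. 0"] exI[of _ "{}"] exI[of _ "1::real"] conjI refl)
         (simp_all add: zero bounded_subset_empty)
    moreover have "{\<psi> \<in> dual K E. \<exists>d<1. \<forall>x\<in>{}. cmod (\<psi> x - 0) \<le> d} = dual K E"
      by (auto intro: exI[of _ 0])
    ultimately have "dual K E \<in> ?G" by simp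
    then have "\<Union> ?G = dual K E" by (intro equalityI Union_upper Union_least) auto
    then show ?thesis by (simp only: strong_topology_def topology_generated_by_topspace)
  qed
  have "continuous_map (strong_topology K E) (top_of_set K) f"
    using f by (simp add: dual_def[of K "strong_dual K E"] operator_def scalar_field_def)
  then have "continuous_map (strong_topology K E) euclidean f" by (simp add: continuous_map_in_subtopology)
  then have "openin (strong_topology K E) {\<phi> \<in> dual K E. f \<phi> \<in> ball 0 1}"
    using openin_continuous_map_preimage[of "strong_topology K E" euclidean f "ball 0 1"] top by simp
  moreover have "(\<lambda>x. 0) \<in> {\<phi> \<in> dual K E. f \<phi> \<in> ball 0 1}"
    using zero scale[OF _ zero, of 0] by simp
  ultimately obtain B e where B: "bounded_subset E B" "0 < e"
    "\<forall>\<psi>\<in>dual K E. (\<forall>x\<in>B. cmod (\<psi> x) \<le> e) \<longrightarrow> \<psi> \<in> {\<phi> \<in> dual K E. f \<phi> \<in> ball 0 1}"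
    by (blast dest: strong_topology_zero_nbhd)
  obtain M where M: "0 < M" "\<And>x. x \<in> B \<Longrightarrow> g x \<le> M"
    using B(1) g unfolding bounded_iff_seminorm by blast
  have BE: "B \<subseteq> carrier E" using B(1) by (simp add: bounded_subset_def)
  show ?thesis
  proof (intro exI[of _ "M / e"] conjI ballI allI impI)
    show "0 \<le> M / e" using M(1) B(2) by simp
    fix \<phi> r assume \<phi>: "\<phi> \<in> dual K E" and r: "0 < r"
      and le: "\<forall>x\<in>carrier E. cmod (\<phi> x) \<le> r * g x"
    \<comment> \<open>the multiple of \<open>\<phi>\<close> that is bounded by \<open>e\<close> on \<open>B\<close>\<close>
    define c where "c = e / (r * M)"
    have c: "0 < c" using B(2) r M(1) by (simp add: c_def)
    have "(\<lambda>x. complex_of_real c * \<phi> x) \<in> {\<phi> \<in> dual K E. f \<phi> \<in> ball 0 1}"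
    proof (intro B(3)[rule_format])
      show "(\<lambda>x. complex_of_real c * \<phi> x) \<in> dual K E" by (rule dual_scale[OF \<phi>]) simp
      fix x assume x: "x \<in> B"
      have "cmod (\<phi> x) \<le> r * g x" using le x BE by blast
      also have "\<dots> \<le> r * M" using M(2)[OF x] r by simp
      finally have "cmod (\<phi> x) \<le> r * M" .
      then have "c * cmod (\<phi> x) \<le> c * (r * M)" using c by (intro mult_left_mono) auto
      moreover have "c * (r * M) = e" using r M(1) by (simp add: c_def)
      ultimately show "cmod (complex_of_real c * \<phi> x) \<le> e" using c by (simp add: norm_mult)
    qed
    then have "c * cmod (f \<phi>) < 1" using scale[OF _ \<phi>, of "complex_of_real c"] c by (simp add: norm_mult)
    then show "cmod (f \<phi>) \<le> M / e * r"
      using B(2) r M(1) by (simp add: c_def field_simps)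
  qed
qed


section \<open>Boundedness of \<open>(p,q)\<close>-\<open>(EV\<^sup>*)\<close> sets\<close>

lemma V_star_imp_EV_star: "V_star_set K p q E A \<Longrightarrow> EV_star_set K p q E A"
  by (simp add: V_star_set_def EV_star_set_def)

text \<open>If a continuous seminorm \<open>g\<close> exceeds \<open>4\<^sup>n\<close> at \<open>a n \<in> A\<close>, then Hahn-Banach yields functionals
  \<open>\<phi> n\<close> dominated by \<open>2\<^sup>-\<^sup>n g\<close> that exceed \<open>2\<^sup>n\<close> at \<open>a n\<close>: a sequence that is equicontinuous and
  weakly summable, although its suprema over \<open>A\<close> do not even tend to zero.\<close>
lemma EV_star_bounded:
  assumes pq: "1 \<le> p" "1 \<le> q" and A: "EV_star_set K p q E A"
  shows "bounded_subset E A"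
  unfolding bounded_iff_seminorm
proof (intro conjI allI impI)
  show AE: "A \<subseteq> carrier E" using A by (simp add: EV_star_set_def)
  fix g assume g: "cont_seminorm g"
  note gs = cont_seminorm_seminorm[OF g]
  show "\<exists>r>0. \<forall>x\<in>A. g x \<le> r"
  proof (rule ccontr)
    assume unbdd: "\<not> (\<exists>r>0. \<forall>x\<in>A. g x \<le> r)"
    have "\<exists>a\<in>A. 4 ^ n < g a" for n :: nat
    proof (rule ccontr)
      assume "\<not> (\<exists>a\<in>A. 4 ^ n < g a)"
      then have "\<forall>x\<in>A. g x \<le> 4 ^ n" by (simp add: not_less)
      moreover have "(0::real) < 4 ^ n" by simp
      ultimately show False using unbdd by blast
    qed
    then obtain a where a: "\<And>n. a n \<in> A" "\<And>n. 4 ^ n < g (a n)" by metis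
    have "\<exists>\<phi>. linear_functional \<phi> \<and> (\<forall>x\<in>carrier E. cmod (\<phi> x) \<le> (1/2) ^ n * g x) \<and>
        cmod (\<phi> (a n)) = (1/2) ^ n * g (a n)" for n
    proof -
      have "seminorm_on (carrier E) (\<lambda>x. (1/2) ^ n * g x)"
        by (rule cont_seminorm_seminorm[OF cont_seminorm_scale[OF g]]) simp
      moreover have "a n \<in> carrier E" using a(1) AE by blast
      ultimately show ?thesis by (rule Hahn_Banach_seminorm)
    qed
    then obtain \<phi> where \<phi>: "\<And>n. linear_functional (\<phi> n)"
      "\<And>n x. x \<in> carrier E \<Longrightarrow> cmod (\<phi> n x) \<le> (1/2) ^ n * g x"
      "\<And>n. cmod (\<phi> n (a n)) = (1/2) ^ n * g (a n)" by metis
    have dual: "\<phi> n \<in> dual K E" for n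
      by (rule in_dual_if_bounded[OF \<phi>(1) cont_seminorm_scale[OF g] \<phi>(2)]) simp_all
    have "weakly_summable K p (strong_dual K E) \<phi>"
      unfolding weakly_summable_def
    proof (intro conjI ballI)
      show "range \<phi> \<subseteq> carrier (strong_dual K E)" using dual by auto
      fix f assume "f \<in> dual K (strong_dual K E)"
      from bidual_bound[OF this g] obtain C where C: "0 \<le> C"
        "\<forall>\<phi>\<in>dual K E. \<forall>r>0. (\<forall>x\<in>carrier E. cmod (\<phi> x) \<le> r * g x) \<longrightarrow> cmod (f \<phi>) \<le> C * r"
        by blast
      have "cmod (f (\<phi> n)) \<le> C * (1/2) ^ n" for n
        using \<phi>(2) by (intro C(2)[rule_format, OF dual]) auto
      then show "in_lp p (\<lambda>n. cmod (f (\<phi> n)))"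
        using C(1) by (intro in_lp_dominated[OF pq(1) in_lp_geometric[OF pq(1)], of _ C]) auto
    qed
    moreover have "equicontinuous K E (range \<phi>)"
    proof -
      obtain U where U: "zero_nbhd E U" "\<And>x. x \<in> U \<Longrightarrow> g x \<le> 1" using g by (auto simp: cont_seminorm_def)
      have UE: "U \<subseteq> carrier E" using U(1) by (simp add: zero_nbhd_def)
      have "cmod (\<phi> n x) \<le> 1" if x: "x \<in> U" for n x
      proof -
        have "cmod (\<phi> n x) \<le> (1/2) ^ n * g x" using \<phi>(2) x UE by blast
        also have "\<dots> \<le> 1 * 1"
          using U(2)[OF x] x UE by (intro mult_mono power_le_one seminorm_onD(1)[OF gs]) auto
        finally show ?thesis by simp
      qed
      then show ?thesis using U(1) dual by (auto simp: equicontinuous_def polar_def)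
    qed
    ultimately have sup: "sup_in_lp q A \<phi>" using A by (simp add: EV_star_set_def)
    then obtain n where n: "\<bar>SUP x\<in>A. cmod (\<phi> n x)\<bar> < 1"
      using in_lp_less_one[OF pq(2)] by (auto simp: sup_in_lp_def)
    have "cmod (\<phi> n (a n)) \<le> (SUP x\<in>A. cmod (\<phi> n x))"
      using sup a(1) by (intro cSUP_upper) (auto simp: sup_in_lp_def)
    moreover have "1 \<le> cmod (\<phi> n (a n))"
    proof -
      have "(1::real) \<le> 2 ^ n" by simp
      also have "\<dots> = (1/2) ^ n * 4 ^ n" by (simp flip: power_mult_distrib)
      also have "\<dots> \<le> (1/2) ^ n * g (a n)" using a(2)[of n] by (intro mult_left_mono) auto
      finally show ?thesis using \<phi>(3) by simp
    qed
    ultimately show False using n by simp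
  qed
qed


section \<open>Closed absolutely convex hulls\<close>

definition disc_hull :: "'a set \<Rightarrow> 'a set" where
  "disc_hull A = (\<lambda>C. closedin (topol E) C \<and> abs_convex K E C) hull A"

lemma disc_hull_subset: "A \<subseteq> disc_hull A"
  unfolding disc_hull_def by (rule hull_subset)

lemma disc_hull_minimal:
  "A \<subseteq> C \<Longrightarrow> closedin (topol E) C \<Longrightarrow> abs_convex K E C \<Longrightarrow> disc_hull A \<subseteq> C"
  unfolding disc_hull_def by (rule hull_minimal) auto

lemma disc_hull_disc:
  assumes "A \<subseteq> carrier E"
  shows "closedin (topol E) (disc_hull A)" "abs_convex K E (disc_hull A)"
proof -
  let ?F = "{C. (closedin (topol E) C \<and> abs_convex K E C) \<and> A \<subseteq> C}"
  have hull: "disc_hull A = \<Inter> ?F" by (simp add: disc_hull_def hull_def)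
  have "closedin (topol E) (carrier E)"
    using closedin_topspace[of "topol E"] by (simp add: topspace_eq_carrier)
  then have carr: "carrier E \<in> ?F" using assms by (simp add: abs_convex_def)
  show "closedin (topol E) (disc_hull A)"
    unfolding hull using carr by (intro closedin_Inter) auto
  show "abs_convex K E (disc_hull A)"
    unfolding abs_convex_def
  proof (intro conjI ballI impI)
    show "disc_hull A \<subseteq> carrier E" using carr hull by blast
    fix x y a b assume xy: "x \<in> disc_hull A" "y \<in> disc_hull A"
      and ab: "a \<in> K" "b \<in> K" "cmod a + cmod b \<le> 1"
    have "a \<odot> x \<oplus> b \<odot> y \<in> C" if "C \<in> ?F" for C
      using that xy ab unfolding hull abs_convex_def by blast
    then show "a \<odot> x \<oplus> b \<odot> y \<in> disc_hull A" unfolding hull by blast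
  qed
qed

lemma seminorm_le_disc_hull:
  assumes f: "cont_seminorm f" and A: "A \<subseteq> carrier E" and s: "0 \<le> s" "\<And>a. a \<in> A \<Longrightarrow> f a \<le> s"
    and x: "x \<in> disc_hull A"
  shows "f x \<le> s"
proof -
  have "disc_hull A \<subseteq> {x \<in> carrier E. f x \<le> s}"
    using A s closedin_seminorm_le[OF f] abs_convex_seminorm_le[OF cont_seminorm_seminorm[OF f]]
    by (intro disc_hull_minimal) auto
  then show ?thesis using x by auto
qed

lemma bounded_disc_hull:
  assumes A: "bounded_subset E A"
  shows "bounded_subset E (disc_hull A)"
  unfolding bounded_iff_seminorm
proof (intro conjI allI impI)
  have AE: "A \<subseteq> carrier E" using A by (simp add: bounded_subset_def)
  show "disc_hull A \<subseteq> carrier E" using disc_hull_disc(2)[OF AE] by (simp add: abs_convex_def)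
  fix g assume g: "cont_seminorm g"
  obtain r where "0 < r" "\<forall>x\<in>A. g x \<le> r" using A g unfolding bounded_iff_seminorm by blast
  then show "\<exists>r>0. \<forall>x\<in>disc_hull A. g x \<le> r"
    using seminorm_le_disc_hull[OF g AE, of r] by (intro exI[of _ r]) auto
qed

text \<open>Both classes are described by suprema of functionals, hence inherited by every set on which these
  suprema are larger by at most a constant factor.\<close>
lemma star_set_dominated:
  assumes q: "1 \<le> q" and B: "B \<noteq> {}" "B \<subseteq> carrier E" and r: "0 \<le> r"
    and dom: "\<forall>\<phi>\<in>dual K E. \<forall>s. (\<forall>a\<in>A. cmod (\<phi> a) \<le> s) \<longrightarrow> (\<forall>b\<in>B. cmod (\<phi> b) \<le> r * s)"
    and is_V: "is_V \<in> {V_star_set K p q E, EV_star_set K p q E}" "is_V A"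
  shows "is_V B"
proof -
  have sup: "sup_in_lp q B \<phi>"
    if "sup_in_lp q A \<phi>" "weakly_summable K p (strong_dual K E) \<phi>" "A \<noteq> {}" for \<phi>
  proof -
    have "range \<phi> \<subseteq> dual K E" using that(2) by (simp add: weakly_summable_def)
    then have "\<phi> n \<in> dual K E" for n by blast
    then show ?thesis using dom by (intro sup_in_lp_dominated[OF q that(1,3) B(1) r]) blast
  qed
  from is_V(1) consider "is_V = V_star_set K p q E" | "is_V = EV_star_set K p q E" by blast
  then show ?thesis
  proof cases
    case 1
    then show ?thesis using is_V(2) sup B unfolding V_star_set_def by simp
  next
    case 2
    then show ?thesis using is_V(2) sup B unfolding EV_star_set_def by simp
  qed
qed

text \<open>The functionals do not grow when passing from \<open>A\<close> to its closed absolutely convex hull \<open>D\<close>, and the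
  Minkowski functional of \<open>D\<close> measures by which multiple of \<open>D\<close> a set is absorbed.\<close>
lemma star_set_of_minkowski_bounded:
  assumes q: "1 \<le> q" and A: "A \<subseteq> carrier E" "A \<noteq> {}" and B: "B \<noteq> {}" "B \<subseteq> disc_span (disc_hull A)"
    and r: "0 \<le> r" "\<And>b. b \<in> B \<Longrightarrow> minkowski (disc_hull A) b \<le> r"
    and is_V: "is_V \<in> {V_star_set K p q E, EV_star_set K p q E}" "is_V A"
  shows "is_V B"
proof -
  note disc = disc_hull_disc(2)[OF A(1)]
  have ne: "disc_hull A \<noteq> {}" using A(2) disc_hull_subset by blast
  have dom: "cmod (\<phi> b) \<le> r * s"
    if \<phi>: "\<phi> \<in> dual K E" and s: "\<And>a. a \<in> A \<Longrightarrow> cmod (\<phi> a) \<le> s" and b: "b \<in> B" for \<phi> s b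
  proof -
    have s0: "0 \<le> s" using A(2) s norm_ge_zero order_trans by blast
    note f = dual_cont_seminorm[OF \<phi>]
    have "cmod (\<phi> b) \<le> s * minkowski (disc_hull A) b"
    proof (rule minkowski_bound[OF disc ne cont_seminorm_seminorm[OF f]])
      show "cmod (\<phi> x) \<le> s" if "x \<in> disc_hull A" for x
        by (rule seminorm_le_disc_hull[OF f A(1) s0 s that])
      show "b \<in> disc_span (disc_hull A)" using b B(2) by blast
    qed
    also have "\<dots> \<le> s * r" using r(2)[OF b] s0 by (rule mult_left_mono)
    finally show ?thesis by (simp add: mult.commute)
  qed
  have BE: "B \<subseteq> carrier E" using B(2) by (auto simp: disc_span_def)
  show ?thesis
    using dom by (intro star_set_dominated[OF q B(1) BE r(1) _ is_V]) blast
qed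

end


section \<open>Normed spaces\<close>

locale normed_module = scalar_module K E
  for K :: "complex set" and E :: "'a topvec" (structure) +
  fixes N :: "'a \<Rightarrow> real"
  assumes norm: "norm_on K E N"
    and topol_eq: "topol E = Metric_space.mtopology (carrier E) (norm_dist E N)"
begin

lemma norm_seminorm: "seminorm_on (carrier E) N"
  using norm by (auto simp: norm_on_def seminorm_on_def)

lemma norm_dist_Metric_space: "Metric_space (carrier E) (norm_dist E N)"
proof
  show "0 \<le> norm_dist E N x y" for x y
    by (simp add: norm_dist_def seminorm_onD(1)[OF norm_seminorm])
  show "norm_dist E N x y = norm_dist E N y x" for x y
    by (simp add: norm_dist_def seminorm_diff(1)[OF norm_seminorm])
  show "norm_dist E N x y = 0 \<longleftrightarrow> x = y" if "x \<in> carrier E" "y \<in> carrier E" for x y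
  proof -
    have "x = y" if "x \<ominus> y = \<zero>"
      using add_diff_eq[of y x] \<open>x \<in> carrier E\<close> \<open>y \<in> carrier E\<close> that by simp
    then show ?thesis using norm that by (auto simp: norm_dist_def norm_on_def)
  qed
  show "norm_dist E N x z \<le> norm_dist E N x y + norm_dist E N y z"
    if "x \<in> carrier E" "y \<in> carrier E" "z \<in> carrier E" for x y z
    using that by (simp add: norm_dist_def seminorm_triangle_diff[OF norm_seminorm])
qed

interpretation metric: Metric_space "carrier E" "norm_dist E N"
  by (rule norm_dist_Metric_space)

lemma in_mball_iff:
  "y \<in> metric.mball x e \<longleftrightarrow> x \<in> carrier E \<and> y \<in> carrier E \<and> N (y \<ominus> x) < e"
  by (auto simp: metric.in_mball norm_dist_def seminorm_diff(1)[OF norm_seminorm])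

declare metric.in_mball [simp del] in_mball_iff [simp]

lemma openin_norm_ball: "openin (topol E) (metric.mball x e)"
  by (simp add: topol_eq)

lemma openin_iff_norm:
  "openin (topol E) W \<longleftrightarrow> W \<subseteq> carrier E \<and>
     (\<forall>x\<in>W. \<exists>e>0. \<forall>y\<in>carrier E. N (y \<ominus> x) < e \<longrightarrow> y \<in> W)"
  unfolding topol_eq metric.openin_mtopology subset_iff in_mball_iff by blast

lemma zero_nbhd_iff_norm:
  "zero_nbhd E U \<longleftrightarrow> U \<subseteq> carrier E \<and> (\<exists>e>0. \<forall>x\<in>carrier E. N x < e \<longrightarrow> x \<in> U)"
proof (intro iffI conjI)
  assume U: "zero_nbhd E U"
  then show "U \<subseteq> carrier E" by (simp add: zero_nbhd_def)
  obtain W where W: "openin (topol E) W" "\<zero> \<in> W" "W \<subseteq> U" using U by (auto simp: zero_nbhd_def)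
  then obtain e where e: "0 < e" "\<forall>y\<in>carrier E. N (y \<ominus> \<zero>) < e \<longrightarrow> y \<in> W"
    unfolding openin_iff_norm by blast
  then show "\<exists>e>0. \<forall>x\<in>carrier E. N x < e \<longrightarrow> x \<in> U"
    using W(3) by (intro exI[of _ e]) auto
next
  assume U: "U \<subseteq> carrier E \<and> (\<exists>e>0. \<forall>x\<in>carrier E. N x < e \<longrightarrow> x \<in> U)"
  then obtain e where e: "0 < e" "\<forall>x\<in>carrier E. N x < e \<longrightarrow> x \<in> U" by blast
  have "metric.mball \<zero> e \<subseteq> U" using e(2) by (auto simp: in_mball_iff)
  moreover have "\<zero> \<in> metric.mball \<zero> e" using e(1) seminorm_zero[OF norm_seminorm] by (simp add: in_mball_iff)
  ultimately show "zero_nbhd E U"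
    using U openin_norm_ball[of "\<zero>" e] unfolding zero_nbhd_def by blast
qed

lemma continuous_map_add:
  "continuous_map (prod_topology (topol E) (topol E)) (topol E) (\<lambda>(x, y). x \<oplus> y)"
  unfolding topol_eq metric.continuous_map_to_metric
proof (intro ballI allI impI)
  fix z and e :: real
  assume z: "z \<in> topspace (prod_topology metric.mtopology metric.mtopology)" and e: "0 < e"
  obtain x y where xy: "z = (x, y)" "x \<in> carrier E" "y \<in> carrier E" using z by auto
  let ?U = "metric.mball x (e/2) \<times> metric.mball y (e/2)"
  have "openin (prod_topology metric.mtopology metric.mtopology) ?U"
    by (simp add: openin_prod_Times_iff)
  moreover have "z \<in> ?U" using xy e by simp
  moreover have "(case w of (x, y) \<Rightarrow> x \<oplus> y) \<in> metric.mball (case z of (x, y) \<Rightarrow> x \<oplus> y) e"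
    if w: "w \<in> ?U" for w
  proof -
    obtain x' y' where xy': "w = (x', y')" "x' \<in> carrier E" "y' \<in> carrier E"
      "N (x' \<ominus> x) < e/2" "N (y' \<ominus> y) < e/2" using w by (auto simp: in_mball_iff)
    have "N ((x' \<oplus> y') \<ominus> (x \<oplus> y)) \<le> N (x' \<ominus> x) + N (y' \<ominus> y)"
      using xy xy' by (simp add: add_diff_add seminorm_onD(3)[OF norm_seminorm])
    then show ?thesis using xy xy' by (simp add: in_mball_iff)
  qed
  ultimately show "\<exists>U. openin (prod_topology metric.mtopology metric.mtopology) U \<and> z \<in> U \<and>
      (\<forall>w\<in>U. (case w of (x, y) \<Rightarrow> x \<oplus> y) \<in> metric.mball (case z of (x, y) \<Rightarrow> x \<oplus> y) e)"
    by (intro exI[of _ ?U] conjI ballI)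
qed

lemma continuous_map_scale:
  "continuous_map (prod_topology (top_of_set K) (topol E)) (topol E) (\<lambda>(c, x). c \<odot> x)"
  unfolding topol_eq metric.continuous_map_to_metric
proof (intro ballI allI impI)
  fix z and e :: real
  assume z: "z \<in> topspace (prod_topology (top_of_set K) metric.mtopology)" and e: "0 < e"
  obtain c x where cx: "z = (c, x)" "c \<in> K" "x \<in> carrier E" using z by auto
  have N0: "0 \<le> N y" if "y \<in> carrier E" for y using seminorm_onD(1)[OF norm_seminorm that] .
  \<comment> \<open>chosen for \<open>b y - c x = b (y - x) + (b - c) x\<close>, where \<open>\<bar>b\<bar> \<le> \<bar>c\<bar> + 1\<close> because of \<open>d1 \<le> 1\<close>\<close>
  define d1 where "d1 = min 1 (e / (2 * (N x + 1)))"
  define d2 where "d2 = e / 2 / (cmod c + 1)"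
  have d: "0 < d1" "0 < d2" "d1 \<le> 1" "d1 * N x \<le> e/2" "(cmod c + 1) * d2 = e/2"
  proof -
    show "0 < d1" "0 < d2" "d1 \<le> 1"
      using e N0[OF cx(3)] by (auto simp: d1_def d2_def add_nonneg_pos)
    have "d1 * N x \<le> e / (2 * (N x + 1)) * (N x + 1)"
      using e N0[OF cx(3)] by (intro mult_mono) (auto simp: d1_def)
    also have "\<dots> = e/2" using N0[OF cx(3)] by (simp add: field_simps)
    finally show "d1 * N x \<le> e/2" .
    have "a * (b / a) = b" if "a \<noteq> 0" for a b :: real using that by simp
    moreover have "cmod c + 1 \<noteq> 0" using norm_ge_zero[of c] by linarith
    ultimately show "(cmod c + 1) * d2 = e/2" unfolding d2_def by blast
  qed
  let ?U = "(K \<inter> ball c d1) \<times> metric.mball x d2"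
  have "openin (prod_topology (top_of_set K) metric.mtopology) ?U"
    by (simp add: openin_prod_Times_iff openin_open_Int)
  moreover have "z \<in> ?U" using cx d by simp
  moreover have "(case w of (c, x) \<Rightarrow> c \<odot> x) \<in> metric.mball (case z of (c, x) \<Rightarrow> c \<odot> x) e"
    if w: "w \<in> ?U" for w
  proof -
    obtain b y where by_: "w = (b, y)" "b \<in> K" "cmod (b - c) < d1" "y \<in> carrier E" "N (y \<ominus> x) < d2"
      using w by (auto simp: in_mball_iff dist_norm norm_minus_commute)
    have "b \<odot> y \<ominus> c \<odot> x = b \<odot> (y \<ominus> x) \<oplus> (b - c) \<odot> x"
    proof -
      have "b \<odot> y \<ominus> c \<odot> x = (b \<odot> y \<ominus> b \<odot> x) \<oplus> (b \<odot> x \<ominus> c \<odot> x)"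
        using by_ cx by (simp add: diff_add_diff)
      moreover have "b \<odot> x \<ominus> c \<odot> x = (b - c) \<odot> x"
        using by_(2) cx(2,3) scale_left_distrib[of b "- c" x] by (simp add: diff_eq_scale)
      ultimately show ?thesis using by_ cx by (simp add: scale_diff_right)
    qed
    then have "N (b \<odot> y \<ominus> c \<odot> x) \<le> N (b \<odot> (y \<ominus> x)) + N ((b - c) \<odot> x)"
      using by_ cx by (simp add: seminorm_onD(3)[OF norm_seminorm])
    also have "\<dots> = cmod b * N (y \<ominus> x) + cmod (b - c) * N x"
      using by_ cx by (simp add: seminorm_onD(2)[OF norm_seminorm])
    also have "\<dots> < e/2 + e/2"
    proof (rule add_less_le_mono)
      have b: "cmod b \<le> cmod c + 1"
        using norm_triangle_sub[of b c] by_(3) d(3) by simp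
      have "cmod b * N (y \<ominus> x) \<le> (cmod c + 1) * N (y \<ominus> x)"
        using b N0[of "y \<ominus> x"] by_ cx by (intro mult_right_mono) auto
      also have "\<dots> < (cmod c + 1) * d2"
        using by_(5) norm_ge_zero[of c] by (intro mult_strict_left_mono) linarith+
      finally show "cmod b * N (y \<ominus> x) < e/2" using d(5) by simp
      show "cmod (b - c) * N x \<le> e/2"
        using mult_right_mono[of "cmod (b - c)" d1 "N x"] by_(3) N0[OF cx(3)] d(4) by simp
    qed
    finally show ?thesis using by_ cx by (simp add: in_mball_iff)
  qed
  ultimately show "\<exists>U. openin (prod_topology (top_of_set K) metric.mtopology) U \<and> z \<in> U \<and>
      (\<forall>w\<in>U. (case w of (c, x) \<Rightarrow> c \<odot> x) \<in> metric.mball (case z of (c, x) \<Rightarrow> c \<odot> x) e)"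
    by (intro exI[of _ ?U] conjI ballI)
qed

lemma norm_ball_convex: "convex_subset E {x \<in> carrier E. N x < e}"
  unfolding convex_subset_def
proof (intro conjI ballI)
  fix x y and t :: real
  assume x: "x \<in> {x \<in> carrier E. N x < e}" and y: "y \<in> {x \<in> carrier E. N x < e}" and t: "t \<in> {0..1}"
  have "N (complex_of_real (1 - t) \<odot> x \<oplus> complex_of_real t \<odot> y)
    \<le> N (complex_of_real (1 - t) \<odot> x) + N (complex_of_real t \<odot> y)"
    using x y by (intro seminorm_onD(3)[OF norm_seminorm]) auto
  also have "\<dots> = (1 - t) * N x + t * N y"
    using x y t by (simp add: seminorm_onD(2)[OF norm_seminorm] del: of_real_diff)
  also have "\<dots> < e" using x y t by (intro convex_bound_lt) auto
  finally show "complex_of_real (1 - t) \<odot> x \<oplus> complex_of_real t \<odot> y \<in> {x \<in> carrier E. N x < e}"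
    using x y by simp
qed auto

theorem normed_locally_convex: "locally_convex_space K E"
proof -
  have "\<exists>C. zero_nbhd E C \<and> convex_subset E C \<and> C \<subseteq> U" if U: "zero_nbhd E U" for U
  proof -
    obtain e where e: "0 < e" "\<forall>x\<in>carrier E. N x < e \<longrightarrow> x \<in> U" using U zero_nbhd_iff_norm by auto
    have "zero_nbhd E {x \<in> carrier E. N x < e}" using e(1) by (auto simp: zero_nbhd_iff_norm)
    then show ?thesis using norm_ball_convex e(2) by (intro exI[of _ "{x \<in> carrier E. N x < e}"]) auto
  qed
  moreover have "Hausdorff_space (topol E)"
    using metric.Hausdorff_space_mtopology by (simp add: topol_eq)
  moreover have "topspace (topol E) = carrier E" by (simp add: topol_eq)
  ultimately show ?thesis
    using continuous_map_add continuous_map_scale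
    by unfold_locales auto
qed

lemma bounded_iff_norm: "bounded_subset E B \<longleftrightarrow> B \<subseteq> carrier E \<and> (\<exists>r>0. \<forall>x\<in>B. N x \<le> r)"
proof (intro iffI conjI)
  assume B: "bounded_subset E B"
  then show "B \<subseteq> carrier E" by (simp add: bounded_subset_def)
  have "zero_nbhd E {x \<in> carrier E. N x < 1}" by (auto simp: zero_nbhd_iff_norm intro: exI[of _ 1])
  then obtain r where r: "0 < r" "B \<subseteq> (\<lambda>x. complex_of_real r \<odot> x) ` {x \<in> carrier E. N x < 1}"
    using B unfolding bounded_subset_def by blast
  have "N x \<le> r" if x: "x \<in> B" for x
  proof -
    obtain u where u: "u \<in> carrier E" "N u < 1" "x = complex_of_real r \<odot> u" using r(2) x by blast
    then show ?thesis using r(1) by (simp add: seminorm_onD(2)[OF norm_seminorm])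
  qed
  then show "\<exists>r>0. \<forall>x\<in>B. N x \<le> r" using r(1) by blast
next
  assume B: "B \<subseteq> carrier E \<and> (\<exists>r>0. \<forall>x\<in>B. N x \<le> r)"
  then obtain r where r: "0 < r" "\<forall>x\<in>B. N x \<le> r" by blast
  have "\<exists>t>0. B \<subseteq> (\<lambda>x. complex_of_real t \<odot> x) ` U" if U: "zero_nbhd E U" for U
  proof -
    obtain e where e: "0 < e" "\<forall>x\<in>carrier E. N x < e \<longrightarrow> x \<in> U" using U zero_nbhd_iff_norm by auto
    define t where "t = 2 * r / e"
    have t: "0 < t" "r / t < e" using r(1) e(1) by (auto simp: t_def)
    have "x \<in> (\<lambda>x. complex_of_real t \<odot> x) ` U" if x: "x \<in> B" for x
    proof -
      have xE: "x \<in> carrier E" using x B by blast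
      have "N (complex_of_real (1 / t) \<odot> x) = N x / t"
        using seminorm_onD(2)[OF norm_seminorm, of "complex_of_real (1 / t)" x] xE t(1)
        by (simp add: norm_divide)
      also have "\<dots> \<le> r / t" using r(2) x t(1) by (simp add: divide_right_mono)
      finally have "complex_of_real (1 / t) \<odot> x \<in> U" using e(2) xE t(2) by simp
      moreover have "x = complex_of_real t \<odot> (complex_of_real (1 / t) \<odot> x)" using xE t(1) by simp
      ultimately show ?thesis by blast
    qed
    then show ?thesis using t(1) by blast
  qed
  then show "bounded_subset E B" using B by (simp add: bounded_subset_def)
qed

end

lemma normed_space_locally_convex:
  assumes K: "K \<in> {\<real>, UNIV}" and L: "normed_space K L"
  shows "locally_convex_space K L"
proof -
  obtain N where N: "norm_on K L N" "topol L = Metric_space.mtopology (carrier L) (norm_dist L N)"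
    "Module.module (scalar_field K) L" using L by (auto simp: normed_space_def)
  interpret Module.module "scalar_field K" L by (rule N(3))
  interpret normed_module K L N by unfold_locales (use K N in auto)
  show ?thesis by (rule normed_locally_convex)
qed


section \<open>Completeness of the Minkowski functional\<close>

lemma compactin_cluster_point:
  assumes C: "compactin X C" and x: "\<And>n::nat. x n \<in> C"
  shows "\<exists>c\<in>C. \<forall>W m. openin X W \<longrightarrow> c \<in> W \<longrightarrow> (\<exists>n\<ge>m. x n \<in> W)"
proof (rule ccontr)
  assume none: "\<not> ?thesis"
  define \<U> where "\<U> = {W. openin X W \<and> (\<forall>\<^sub>F n in sequentially. x n \<notin> W)}"
  have "C \<subseteq> \<Union>\<U>"
  proof
    fix c assume c: "c \<in> C"
    then obtain W m where "openin X W" "c \<in> W" "\<not> (\<exists>n\<ge>m. x n \<in> W)" using none by blast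
    then show "c \<in> \<Union>\<U>" unfolding \<U>_def eventually_sequentially by blast
  qed
  then obtain \<F> where F: "finite \<F>" "\<F> \<subseteq> \<U>" "C \<subseteq> \<Union>\<F>"
  proof -
    have "\<forall>W\<in>\<U>. openin X W" by (simp add: \<U>_def)
    then show ?thesis using C \<open>C \<subseteq> \<Union>\<U>\<close> that unfolding compactin_def by blast
  qed
  have "\<forall>\<^sub>F n in sequentially. \<forall>W\<in>\<F>. x n \<notin> W"
    using F by (intro eventually_ball_finite) (auto simp: \<U>_def)
  then obtain n where "\<forall>W\<in>\<F>. x n \<notin> W" by (auto simp: eventually_sequentially)
  then show False using F(3) x by blast
qed

context lcs
begin

text \<open>A Cauchy sequence with respect to the Minkowski functional has a subsequence \<open>z\<close> whose increments
  are so small that \<open>2\<^sup>n (z (n+1) - z n)\<close> still is a null sequence of \<open>E\<close>. All differences of \<open>z\<close>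
  lie in a multiple of the closed absolutely convex hull of that null sequence, so by local
  completeness \<open>z\<close> has a cluster point \<open>l\<close> in \<open>E\<close>. As the multiples of the disc are closed in \<open>E\<close>, the Cauchy
  estimates carry over to the differences with \<open>l\<close>.\<close>
theorem minkowski_complete:
  assumes lc: "locally_complete K E" and D: "closedin (topol E) D" "abs_convex K E D" "D \<noteq> {}"
    and bdd: "bounded_subset E D" and x: "\<And>n::nat. x n \<in> disc_span D"
    and cauchy: "\<And>e. 0 < e \<Longrightarrow> \<exists>m. \<forall>k\<ge>m. \<forall>l\<ge>m. minkowski D (x k \<ominus> x l) < e"
  shows "\<exists>l\<in>disc_span D. \<forall>e>0. \<exists>m. \<forall>n\<ge>m. minkowski D (x n \<ominus> l) \<le> e"
proof -
  note disc = D(2,3)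
  have carr [simp]: "x n \<in> carrier E" for n using x disc_span_carrier by blast
  have "\<exists>m. \<forall>k\<ge>m. \<forall>l\<ge>m. minkowski D (x k \<ominus> x l) < (1/4) ^ n" for n
    by (rule cauchy) simp
  then obtain m where m: "\<And>n k l. m n \<le> k \<Longrightarrow> m n \<le> l \<Longrightarrow> minkowski D (x k \<ominus> x l) < (1/4) ^ n"
    by metis
  \<comment> \<open>an increasing majorant of \<open>m\<close>\<close>
  define r where "r n = (\<Sum>i\<le>n. Suc (m i))" for n
  have r: "m n \<le> r n" "n \<le> r n" "r n \<le> r (Suc n)" for n
  proof -
    show "m n \<le> r n"
      using member_le_sum[of n "{..n}" "\<lambda>i. Suc (m i)"] by (simp add: r_def)
    show "n \<le> r n" by (induction n) (simp_all add: r_def)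
    show "r n \<le> r (Suc n)" by (simp add: r_def)
  qed
  define z where "z n = x (r n)" for n
  have z [simp]: "z n \<in> carrier E" and zs: "z n \<in> disc_span D" for n using x by (simp_all add: z_def)
  define y where "y n = complex_of_real (2 ^ n) \<odot> (z (Suc n) \<ominus> z n)" for n
  have y [simp]: "y n \<in> carrier E" for n by (simp add: y_def)
  have ys: "y n \<in> disc_span D" for n
    unfolding y_def by (intro disc_span_scale[OF disc] disc_span_diff[OF disc] zs of_real_K)
  have y_small: "minkowski D (y n) \<le> (1/2) ^ n" for n
  proof -
    have "minkowski D (y n) = 2 ^ n * minkowski D (z (Suc n) \<ominus> z n)"
      unfolding y_def using minkowski_scale[OF disc disc_span_diff[OF disc zs zs], of "complex_of_real (2 ^ n)"]
      by (simp add: norm_power)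
    also have "\<dots> \<le> 2 ^ n * (1/4) ^ n"
      using m[of n "r (Suc n)" "r n"] r(1)[of n] r(3)[of n] by (intro mult_left_mono) (auto simp: z_def)
    also have "\<dots> = (1/2) ^ n" by (simp flip: power_mult_distrib)
    finally show ?thesis .
  qed
  have "limitin (topol E) y \<zero> sequentially"
    unfolding limitin_def
  proof (intro conjI allI impI)
    show "\<zero> \<in> topspace (topol E)" by (simp add: topspace_eq_carrier)
    fix W assume W: "openin (topol E) W \<and> \<zero> \<in> W"
    then obtain g where g: "cont_seminorm g" "\<forall>v\<in>carrier E. g (v \<ominus> \<zero>) < 1 \<longrightarrow> v \<in> W"
      unfolding openin_iff_seminorm by blast
    obtain M where M: "0 < M" "\<forall>v\<in>D. g v \<le> M"
      using bdd g(1) unfolding bounded_iff_seminorm by blast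
    have "(\<lambda>n. M * (1/2) ^ n) \<longlonglongrightarrow> 0"
      by (intro tendsto_mult_right_zero LIMSEQ_power_zero) simp
    then have "\<forall>\<^sub>F n in sequentially. M * (1/2) ^ n < 1" by (rule order_tendstoD(2)) simp
    then show "\<forall>\<^sub>F n in sequentially. y n \<in> W"
    proof (rule eventually_mono)
      fix n assume n: "M * (1/2) ^ n < 1"
      have "g (y n) \<le> M * minkowski D (y n)"
        using M(2) by (intro minkowski_bound[OF disc cont_seminorm_seminorm[OF g(1)] _ ys]) blast
      also have "\<dots> \<le> M * (1/2) ^ n" using M(1) y_small[of n] by (intro mult_left_mono) auto
      finally show "y n \<in> W" using n g(2) by simp
    qed
  qed
  moreover have range_y: "range y \<subseteq> carrier E" by (rule image_subsetI) (rule y)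
  ultimately have compact: "compactin (topol E) (disc_hull (range y))"
    using lc unfolding locally_complete_def disc_hull_def by blast
  let ?C = "disc_hull (range y)"
  have C: "abs_convex K E ?C" "?C \<noteq> {}"
    using disc_hull_disc(2)[OF range_y] disc_hull_subset[of "range y"] by auto
  have yC: "y n \<in> ?C" for n using disc_hull_subset[of "range y"] by auto
  \<comment> \<open>Multiplied by \<open>2\<^sup>k / 2\<close>, the sum of the increments from \<open>k\<close> on is the sum of the \<open>y i\<close> from \<open>k\<close> on
    with the weights 1/2, 1/4, ...; peeling off the first one halves the rest.\<close>
  have diff_C: "complex_of_real (2 ^ k / 2) \<odot> (z (k + n) \<ominus> z k) \<in> ?C" for n k
  proof (induction n arbitrary: k)
    case 0
    then show ?case using zero_in_disc[OF C] by simp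
  next
    case (Suc n)
    let ?a = "complex_of_real (2 ^ Suc k / 2) \<odot> (z (Suc k + n) \<ominus> z (Suc k))"
    have "complex_of_real (1/2) \<odot> ?a \<oplus> complex_of_real (1/2) \<odot> y k \<in> ?C"
      by (rule disc_combine[OF C(1) C(2) Suc.IH yC]) (auto simp: norm_divide)
    moreover have "complex_of_real (1/2) \<odot> ?a
      = complex_of_real (2 ^ k / 2) \<odot> (z (Suc k + n) \<ominus> z (Suc k))"
      by (subst scale_scale) simp_all
    moreover have "complex_of_real (1/2) \<odot> y k = complex_of_real (2 ^ k / 2) \<odot> (z (Suc k) \<ominus> z k)"
      unfolding y_def by (subst scale_scale) simp_all
    moreover have "z (k + Suc n) \<ominus> z k = (z (Suc k + n) \<ominus> z (Suc k)) \<oplus> (z (Suc k) \<ominus> z k)"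
      by (simp add: diff_add_diff)
    ultimately show ?case by (simp only: scale_right_distrib of_real_K z M.minus_closed)
  qed
  define w where "w n = complex_of_real (1/2) \<odot> (z n \<ominus> z 0)" for n
  have wC: "w n \<in> ?C" for n using diff_C[of 0 n] unfolding w_def by simp
  from compactin_cluster_point[OF compact wC] obtain c where c: "c \<in> ?C"
    and cluster: "\<forall>W k. openin (topol E) W \<longrightarrow> c \<in> W \<longrightarrow> (\<exists>n\<ge>k. w n \<in> W)" ..
  have cE [simp]: "c \<in> carrier E" using c C(1) by (auto simp: abs_convex_def)
  define l where "l = z 0 \<oplus> complex_of_real 2 \<odot> c"
  have l [simp]: "l \<in> carrier E" by (simp add: l_def)
  have near: "\<exists>n\<ge>k. g (z n \<ominus> l) < 1" if g: "cont_seminorm g" for g k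
  proof -
    have g2: "cont_seminorm (\<lambda>v. 2 * g v)" by (rule cont_seminorm_scale[OF g]) simp
    have "c \<in> {v \<in> carrier E. 2 * g (v \<ominus> c) < 1}"
      using seminorm_zero[OF cont_seminorm_seminorm[OF g]] by simp
    then obtain n where n: "k \<le> n" "2 * g (w n \<ominus> c) < 1"
      using cluster openin_seminorm_ball[OF g2 cE] by blast
    have "complex_of_real 2 \<odot> (w n \<ominus> c) = (z n \<ominus> z 0) \<ominus> complex_of_real 2 \<odot> c"
      by (simp add: w_def scale_diff_right)
    also have "\<dots> = z n \<ominus> l"
      using add_diff_add[of "z 0" "z n \<ominus> z 0" "z 0" "complex_of_real 2 \<odot> c"] by (simp add: l_def)
    finally have "g (z n \<ominus> l) = 2 * g (w n \<ominus> c)"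
      using seminorm_onD(2)[OF cont_seminorm_seminorm[OF g], of "complex_of_real 2" "w n \<ominus> c"]
      by (simp add: w_def)
    then show ?thesis using n by auto
  qed
  have lim: "\<exists>k. \<forall>n\<ge>k. complex_of_real (1 / e) \<odot> (x n \<ominus> l) \<in> D" if e: "0 < e" for e
  proof -
    obtain k where k: "\<forall>i\<ge>k. \<forall>j\<ge>k. minkowski D (x i \<ominus> x j) < e" using cauchy[OF e] by blast
    have "complex_of_real (1 / e) \<odot> (x n \<ominus> l) \<in> D" if n: "k \<le> n" for n
    proof (rule closedin_approx[OF D(1)])
      fix g assume g: "cont_seminorm g"
      have "cont_seminorm (\<lambda>v. 1 / e * g v)" by (rule cont_seminorm_scale[OF g]) (use e in simp)
      then obtain i where i: "k \<le> i" "1 / e * g (z i \<ominus> l) < 1" using near by blast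
      let ?d = "complex_of_real (1 / e) \<odot> (x n \<ominus> z i)"
      have "minkowski D (x n \<ominus> z i) < e" using k[rule_format, OF n, of "r i"] i(1) r(2)[of i] by (simp add: z_def)
      then have "?d \<in> D" by (rule minkowski_less[OF disc disc_span_diff[OF disc x zs]])
      moreover have "?d \<ominus> complex_of_real (1 / e) \<odot> (x n \<ominus> l) = complex_of_real (1 / e) \<odot> (l \<ominus> z i)"
        using scale_diff_right[of "complex_of_real (1 / e)" "x n \<ominus> z i" "x n \<ominus> l"]
        by (simp add: diff_diff_cancel)
      moreover have "g (complex_of_real (1 / e) \<odot> (l \<ominus> z i)) < 1"
        using seminorm_onD(2)[OF cont_seminorm_seminorm[OF g], of "complex_of_real (1 / e)" "l \<ominus> z i"]
          seminorm_diff(1)[OF cont_seminorm_seminorm[OF g], of l "z i"] i(2) e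
        by (simp add: norm_divide)
      ultimately show "\<exists>d\<in>D. g (d \<ominus> complex_of_real (1 / e) \<odot> (x n \<ominus> l)) < 1" by metis
    qed simp
    then show ?thesis by blast
  qed
  have "l \<in> disc_span D"
  proof -
    obtain k where "x k \<ominus> l \<in> D" using lim[of 1] by auto
    then have "x k \<ominus> l \<in> disc_span D" using in_disc_minkowski[OF disc] by blast
    then have "x k \<ominus> (x k \<ominus> l) \<in> disc_span D" by (rule disc_span_diff[OF disc x])
    moreover have "x k \<ominus> (x k \<ominus> l) = l" using diff_diff_cancel[of "x k" "\<zero>" l] by simp
    ultimately show ?thesis by simp
  qed
  moreover have "\<exists>k. \<forall>n\<ge>k. minkowski D (x n \<ominus> l) \<le> e" if e: "0 < e" for e
    using lim[OF e] minkowski_le[OF disc e] by blast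
  ultimately show ?thesis by blast
qed


section \<open>The normed space spanned by a bounded disc\<close>

text \<open>The span is copied into the left summand of a sum type, since the spaces \<open>L\<close> of the theorem range over
  such a type.\<close>
definition disc_space :: "'a set \<Rightarrow> ('a + 'b) topvec" where
  "disc_space D = \<lparr>carrier = Inl ` disc_span D, monoid.mult = undefined, one = undefined,
     ring.zero = Inl \<zero>, add = (\<lambda>x y. Inl (projl x \<oplus> projl y)),
     smult = (\<lambda>c x. Inl (c \<odot> projl x)),
     topol = Metric_space.mtopology (Inl ` disc_span D)
       (\<lambda>x y. if x \<in> Inl ` disc_span D \<and> y \<in> Inl ` disc_span D
          then minkowski D (projl x \<ominus> projl y) else 0)\<rparr>"

context
  fixes D and L :: "('a + 'b) topvec"
  assumes L: "L = disc_space D" and disc: "abs_convex K E D" "D \<noteq> {}" and bdd: "bounded_subset E D"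
begin

lemma disc_space_simps:
  "carrier L = Inl ` disc_span D" "\<zero>\<^bsub>L\<^esub> = Inl \<zero>" "Inl x \<oplus>\<^bsub>L\<^esub> Inl y = Inl (x \<oplus> y)"
  "c \<odot>\<^bsub>L\<^esub> Inl x = Inl (c \<odot> x)"
  by (simp_all add: L disc_space_def)

lemma disc_space_module: "Module.module (scalar_field K) L"
proof (rule Module.moduleI)
  show "cring (scalar_field K)" by (rule R.is_cring)
  show "abelian_group L"
  proof (rule abelian_groupI)
    fix x assume "x \<in> carrier L"
    then obtain a where a: "x = Inl a" "a \<in> disc_span D" by (auto simp: disc_space_simps)
    have "Inl ((- 1) \<odot> a) \<oplus>\<^bsub>L\<^esub> x = \<zero>\<^bsub>L\<^esub>"
      using a by (simp add: disc_space_simps disc_span_carrier M.a_comm[of "(- 1) \<odot> a" a])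
    moreover have "Inl ((- 1) \<odot> a) \<in> carrier L"
      using a disc_span_scale[OF disc, of a "- 1"] by (simp add: disc_space_simps)
    ultimately show "\<exists>y\<in>carrier L. y \<oplus>\<^bsub>L\<^esub> x = \<zero>\<^bsub>L\<^esub>" by blast
  qed (auto simp: disc_space_simps disc_span_carrier M.a_ac zero_minkowski[OF disc]
      intro: disc_span_add[OF disc])
qed (auto simp: disc_space_simps scalar_field_def disc_span_carrier scale_left_distrib
    scale_right_distrib intro: disc_span_scale[OF disc])

lemma disc_space_minus:
  assumes "a \<in> disc_span D" "b \<in> disc_span D"
  shows "Inl a \<ominus>\<^bsub>L\<^esub> Inl b = Inl (a \<ominus> b)"
proof -
  interpret L: Module.module "scalar_field K" L by (rule disc_space_module)
  interpret L: scalar_module K L by unfold_locales (rule K_cases)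
  show ?thesis
    using assms L.diff_eq_scale[of "Inl a" "Inl b"]
    by (simp add: disc_space_simps disc_span_carrier diff_eq_scale)
qed

text \<open>By boundedness of the disc, every continuous seminorm is dominated by a multiple of the
  Minkowski functional, and the continuous seminorms separate points.\<close>
lemma minkowski_zero_iff:
  assumes x: "x \<in> disc_span D"
  shows "minkowski D x = 0 \<longleftrightarrow> x = \<zero>"
proof
  assume zero: "minkowski D x = 0"
  show "x = \<zero>"
  proof (rule seminorm_separates[OF disc_span_carrier[OF x]])
    fix g assume g: "cont_seminorm g"
    note gs = cont_seminorm_seminorm[OF g]
    obtain M where M: "0 < M" "\<forall>v\<in>D. g v \<le> M"
      using bdd g unfolding bounded_iff_seminorm by blast
    have "g x \<le> M * minkowski D x" using M(2) by (intro minkowski_bound[OF disc gs _ x]) blast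
    then show "g x = 0" using zero seminorm_onD(1)[OF gs disc_span_carrier[OF x]] by simp
  qed
qed (simp add: zero_minkowski[OF disc])

lemma disc_space_norm: "norm_on K L (minkowski D \<circ> projl)"
  by (auto simp: norm_on_def disc_space_simps minkowski_nonneg[OF disc] minkowski_zero_iff
      minkowski_scale[OF disc] minkowski_add[OF disc])

lemma disc_space_normed_module: "normed_module K L (minkowski D \<circ> projl)"
proof -
  interpret L: Module.module "scalar_field K" L by (rule disc_space_module)
  have "norm_dist L (minkowski D \<circ> projl) = (\<lambda>x y. if x \<in> Inl ` disc_span D \<and> y \<in> Inl ` disc_span D
      then minkowski D (projl x \<ominus> projl y) else 0)"
    by (intro ext) (auto simp: norm_dist_def disc_space_simps disc_space_minus)
  then have "topol L = Metric_space.mtopology (carrier L) (norm_dist L (minkowski D \<circ> projl))"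
    unfolding disc_space_simps by (simp add: L disc_space_def)
  then show ?thesis by unfold_locales (use K_cases disc_space_norm in auto)
qed

lemma disc_space_normed: "normed_space K L"
  using disc_space_module disc_space_norm normed_module.topol_eq[OF disc_space_normed_module]
  unfolding normed_space_def by blast

lemma disc_space_inclusion: "operator K L E projl"
proof -
  interpret L: normed_module K L "minkowski D \<circ> projl" by (rule disc_space_normed_module)
  have "openin (topol L) {x \<in> carrier L. projl x \<in> W}" if W: "openin (topol E) W" for W
    unfolding L.openin_iff_norm
  proof (intro conjI ballI)
    fix x assume "x \<in> {x \<in> carrier L. projl x \<in> W}"
    then obtain a where a: "x = Inl a" "a \<in> disc_span D" "a \<in> W" by (auto simp: disc_space_simps)
    obtain g where g: "cont_seminorm g" "\<And>v. v \<in> carrier E \<Longrightarrow> g (v \<ominus> a) < 1 \<Longrightarrow> v \<in> W"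
      using W a(3) unfolding openin_iff_seminorm by blast
    obtain M where M: "0 < M" "\<forall>v\<in>D. g v \<le> M"
      using bdd g(1) unfolding bounded_iff_seminorm by blast
    have "b \<in> W" if b: "b \<in> disc_span D" "minkowski D (b \<ominus> a) < 1 / M" for b
    proof -
      have "g (b \<ominus> a) \<le> M * minkowski D (b \<ominus> a)"
        using M(2) by (intro minkowski_bound[OF disc cont_seminorm_seminorm[OF g(1)]]
            disc_span_diff[OF disc] a b) blast
      also have "\<dots> < 1" using b(2) M(1) by (simp add: field_simps)
      finally show ?thesis using g(2) b(1) disc_span_carrier by blast
    qed
    then show "\<exists>e>0. \<forall>y\<in>carrier L. (minkowski D \<circ> projl) (y \<ominus>\<^bsub>L\<^esub> x) < e \<longrightarrow>
        y \<in> {x \<in> carrier L. projl x \<in> W}"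
      using M(1) a by (intro exI[of _ "1 / M"]) (auto simp: disc_space_simps disc_space_minus)
  qed auto
  moreover have "topspace (topol L) = carrier L"
    using locally_convex_space.topspace_eq_carrier[OF L.normed_locally_convex] .
  ultimately have "continuous_map (topol L) (topol E) projl"
    by (auto simp: continuous_map_def topspace_eq_carrier disc_space_simps disc_span_carrier)
  then show ?thesis by (auto simp: operator_def disc_space_simps)
qed

lemma disc_space_bounded:
  "bounded_subset L B \<longleftrightarrow> B \<subseteq> Inl ` disc_span D \<and> (\<exists>r>0. \<forall>x\<in>B. minkowski D (projl x) \<le> r)"
  using normed_module.bounded_iff_norm[OF disc_space_normed_module]
  by (simp add: disc_space_simps)

lemma disc_space_banach:
  assumes lc: "locally_complete K E" and cl: "closedin (topol E) D"
  shows "banach_space K L"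
proof -
  interpret L: normed_module K L "minkowski D \<circ> projl" by (rule disc_space_normed_module)
  interpret metric: Metric_space "carrier L" "norm_dist L (minkowski D \<circ> projl)"
    by (rule L.norm_dist_Metric_space)
  have dist: "norm_dist L (minkowski D \<circ> projl) (Inl a) (Inl b) = minkowski D (a \<ominus> b)"
    if "a \<in> disc_span D" "b \<in> disc_span D" for a b
    using that by (simp add: norm_dist_def disc_space_simps disc_space_minus)
  have "\<exists>l. limitin metric.mtopology \<sigma> l sequentially" if \<sigma>: "metric.MCauchy \<sigma>" for \<sigma>
  proof -
    define x where "x n = projl (\<sigma> n)" for n
    have "\<sigma> n \<in> carrier L" for n
      using \<sigma> unfolding metric.MCauchy_def by blast
    then have \<sigma>_range: "\<sigma> n \<in> Inl ` disc_span D" for n by (simp add: disc_space_simps)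
    have x: "x n \<in> disc_span D" "\<sigma> n = Inl (x n)" for n
      using \<sigma>_range[of n] by (auto simp: x_def)
    have "\<exists>l\<in>disc_span D. \<forall>e>0. \<exists>m. \<forall>n\<ge>m. minkowski D (x n \<ominus> l) \<le> e"
    proof (rule minkowski_complete[OF lc cl disc bdd x(1)])
      fix e :: real assume "0 < e"
      then show "\<exists>m. \<forall>k\<ge>m. \<forall>l\<ge>m. minkowski D (x k \<ominus> x l) < e"
        using \<sigma> unfolding metric.MCauchy_def x(2) by (simp add: dist x(1))
    qed
    then obtain l where l: "l \<in> disc_span D" "\<forall>e>0. \<exists>m. \<forall>n\<ge>m. minkowski D (x n \<ominus> l) \<le> e" by blast
    have "limitin metric.mtopology \<sigma> (Inl l) sequentially"
      unfolding metric.limitin_metric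
    proof (intro conjI allI impI)
      show "Inl l \<in> carrier L" using l(1) by (simp add: disc_space_simps)
      fix e :: real assume e: "0 < e"
      then obtain m where m: "\<forall>n\<ge>m. minkowski D (x n \<ominus> l) \<le> e / 2" using l(2) half_gt_zero by blast
      have "\<sigma> n \<in> carrier L \<and> norm_dist L (minkowski D \<circ> projl) (\<sigma> n) (Inl l) < e" if "m \<le> n" for n
        using m[rule_format, OF that] x l(1) e by (simp add: dist disc_space_simps)
      then show "\<forall>\<^sub>F n in sequentially. \<sigma> n \<in> carrier L \<and>
          norm_dist L (minkowski D \<circ> projl) (\<sigma> n) (Inl l) < e"
        unfolding eventually_sequentially by blast
    qed
    then show ?thesis by blast
  qed
  then have "Metric_space.mcomplete (carrier L) (norm_dist L (minkowski D \<circ> projl))"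
    by (simp add: metric.mcomplete_def)
  then show ?thesis
    using disc_space_module disc_space_norm L.topol_eq unfolding banach_space_def by blast
qed

end


section \<open>Operators and precompactness\<close>

lemma star_set_disc_hull:
  assumes p: "1 \<le> p" and q: "1 \<le> q"
    and is_V: "is_V \<in> {V_star_set K p q E, EV_star_set K p q E}" and A: "is_V A"
  shows "A \<subseteq> carrier E" "A \<noteq> {}" "abs_convex K E (disc_hull A)" "disc_hull A \<noteq> {}"
    "bounded_subset E (disc_hull A)" "closedin (topol E) (disc_hull A)"
proof -
  have EV: "EV_star_set K p q E A"
    using is_V A by (elim insertE emptyE) (simp_all add: V_star_imp_EV_star)
  then show ne: "A \<noteq> {}" and AE: "A \<subseteq> carrier E" by (simp_all add: EV_star_set_def)
  show "bounded_subset E (disc_hull A)"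
    by (rule bounded_disc_hull[OF EV_star_bounded[OF p q EV]])
  show "disc_hull A \<noteq> {}" using ne disc_hull_subset[of A] by blast
  show "closedin (topol E) (disc_hull A)" "abs_convex K E (disc_hull A)"
    by (rule disc_hull_disc[OF AE])+
qed

lemma precompact_subset_mono:
  assumes AB: "A \<subseteq> B" and B: "precompact_subset E B"
  shows "precompact_subset E A"
  unfolding precompact_subset_def
proof (intro conjI allI impI)
  show "A \<subseteq> carrier E" using AB B unfolding precompact_subset_def by (elim conjE) (rule order_trans)
  fix U assume "zero_nbhd E U"
  then obtain F where "finite F" "F \<subseteq> carrier E" "B \<subseteq> F <+>\<^bsub>E\<^esub> U"
    using B unfolding precompact_subset_def by metis
  then show "\<exists>F. finite F \<and> F \<subseteq> carrier E \<and> A \<subseteq> F <+>\<^bsub>E\<^esub> U"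
    using AB by (intro exI[of _ F]) simp
qed

text \<open>The assertion about operators is applied to the inclusion of the span of \<open>D\<close>: its values on
  the bounded copy of \<open>D\<close> form the set \<open>D\<close>, which contains \<open>A\<close>.\<close>
lemma precompact_if_disc_space_precompact:
  fixes A :: "'a set"
  defines "D \<equiv> disc_hull A" and "L \<equiv> disc_space (disc_hull A) :: ('a + 'b) topvec"
  assumes p: "1 \<le> p" and q: "1 \<le> q"
    and is_V: "is_V \<in> {V_star_set K p q E, EV_star_set K p q E}" and A: "is_V A"
    and factor: "operator K L E projl \<and> maps_bounded_to is_V L projl \<Longrightarrow>
      maps_bounded_to (precompact_subset E) L projl"
  shows "precompact_subset E A"
proof -
  note hull = star_set_disc_hull[OF p q is_V A]
  have AD: "A \<subseteq> D" unfolding D_def by (rule disc_hull_subset)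
  have disc: "abs_convex K E D" "D \<noteq> {}" and bdd: "bounded_subset E D"
    unfolding D_def by (rule hull)+
  have L: "L = disc_space D" by (simp add: L_def D_def)
  have "maps_bounded_to is_V L projl"
    unfolding maps_bounded_to_def
  proof (intro allI impI)
    fix B assume "bounded_subset L B \<and> B \<noteq> {}"
    then obtain r where B: "B \<noteq> {}" "B \<subseteq> Inl ` disc_span D" and r: "0 < r" "\<forall>x\<in>B. minkowski D (projl x) \<le> r"
      unfolding disc_space_bounded[OF L disc bdd] by blast
    have "projl ` B \<subseteq> disc_span D"
      using B(2) by auto
    then show "is_V (projl ` B)"
      using B(1) r unfolding D_def
      by (intro star_set_of_minkowski_bounded[OF q hull(1,2) _ _ _ _ is_V A, of _ r]) auto
  qed
  then have "maps_bounded_to (precompact_subset E) L projl"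
    by (intro factor conjI disc_space_inclusion[OF L disc bdd])
  then have pre: "\<forall>B. bounded_subset L B \<and> B \<noteq> {} \<longrightarrow> precompact_subset E (projl ` B)"
    by (simp only: maps_bounded_to_def)
  have bounded: "bounded_subset L (Inl ` D)"
    using in_disc_minkowski[OF disc] unfolding disc_space_bounded[OF L disc bdd]
    by (intro conjI exI[of _ 1]) auto
  have ne: "(Inl ` D :: ('a + 'b) set) \<noteq> {}" using disc(2) by simp
  have "precompact_subset E (projl ` (Inl ` D :: ('a + 'b) set))"
    by (rule mp[OF spec[OF pre] conjI[OF bounded ne]])
  then have "precompact_subset E D" by (simp add: image_image)
  then show ?thesis by (rule precompact_subset_mono[OF AD])
qed

end

theorem theorem7p13:
  fixes K :: "complex set" and E :: "'a topvec" and p q :: ennreal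
    and is_V :: "'a set \<Rightarrow> bool"
  assumes "K \<in> {\<real>, UNIV}"
    and "locally_convex_space K E"
    and "1 \<le> p" and "p \<le> q" and "q \<le> \<infinity>"
    and "is_V \<in> {V_star_set K p q E, EV_star_set K p q E}"
  shows
    "((\<forall>A. is_V A \<longrightarrow> precompact_subset E A) \<longleftrightarrow>
      (\<forall>L :: ('a + 'b) topvec. locally_convex_space K L \<longrightarrow>
        (\<forall>T. operator K L E T \<and> maps_bounded_to is_V L T \<longrightarrow>
           maps_bounded_to (precompact_subset E) L T))) \<and>
     ((\<forall>A. is_V A \<longrightarrow> precompact_subset E A) \<longleftrightarrow>
      (\<forall>L :: ('a + 'b) topvec. normed_space K L \<longrightarrow>
        (\<forall>T. operator K L E T \<and> maps_bounded_to is_V L T \<longrightarrow>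
           maps_bounded_to (precompact_subset E) L T))) \<and>
     (locally_complete K E \<longrightarrow>
      ((\<forall>A. is_V A \<longrightarrow> precompact_subset E A) \<longleftrightarrow>
       (\<forall>L :: ('a + 'b) topvec. banach_space K L \<longrightarrow>
         (\<forall>T. operator K L E T \<and> maps_bounded_to is_V L T \<longrightarrow>
            maps_bounded_to (precompact_subset E) L T))))"
proof -
  interpret locally_convex_space K E by (rule assms(2))
  interpret lcs K E by unfold_locales (rule assms(1))
  have q: "1 \<le> q" using assms(3,4) by (rule order_trans)
  note hull = star_set_disc_hull[OF assms(3) q assms(6)]
  define factors where "factors L \<longleftrightarrow> (\<forall>T. operator K L E T \<and> maps_bounded_to is_V L T \<longrightarrow>
    maps_bounded_to (precompact_subset E) L T)" for L :: "('a + 'b) topvec"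
  define Vp where "Vp \<longleftrightarrow> (\<forall>A. is_V A \<longrightarrow> precompact_subset E A)"
  have all: "factors L" if Vp for L
    using that unfolding factors_def maps_bounded_to_def Vp_def by blast
  have precompact: "precompact_subset E A" if A: "is_V A" and f: "factors (disc_space (disc_hull A))" for A
    by (rule precompact_if_disc_space_precompact[OF assms(3) q assms(6) A])
       (rule mp[OF spec[OF f[unfolded factors_def]]])
  have normed: Vp if n: "\<And>L. normed_space K L \<Longrightarrow> factors L"
    unfolding Vp_def
  proof (intro allI impI)
    fix A assume A: "is_V A"
    show "precompact_subset E A"
      by (rule precompact[OF A n[OF disc_space_normed[OF refl hull(3-5)[OF A]]]])
  qed
  have banach: Vp if lc: "locally_complete K E" and b: "\<And>L. banach_space K L \<Longrightarrow> factors L"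
    unfolding Vp_def
  proof (intro allI impI)
    fix A assume A: "is_V A"
    show "precompact_subset E A"
      by (rule precompact[OF A b[OF disc_space_banach[OF refl hull(3-5)[OF A] lc hull(6)[OF A]]]])
  qed
  have lcs: Vp if "\<And>L. locally_convex_space K L \<Longrightarrow> factors L"
    by (rule normed[OF that[OF normed_space_locally_convex[OF assms(1)]]])
  have "Vp \<longleftrightarrow> (\<forall>L. locally_convex_space K L \<longrightarrow> factors L)" using all lcs by blast
  moreover have "Vp \<longleftrightarrow> (\<forall>L. normed_space K L \<longrightarrow> factors L)" using all normed by blast
  moreover have "locally_complete K E \<longrightarrow> (Vp \<longleftrightarrow> (\<forall>L. banach_space K L \<longrightarrow> factors L))"
    using all banach by blast
  ultimately show ?thesis unfolding Vp_def factors_def by (intro conjI)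
qed

end
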